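(* Let $\mu,\nu\in\Lambda_2(\mathbb{R}^d)$. Then $$\mathcal{C}_2^\Lambda(\mu,\nu)=\sup_{\varphi,\psi}\left[\int_{\mathbb{R}^d}\varphi(x)\,d\mu(x)+\int_{\mathbb{R}^d}\psi(y)\,d\nu(y)\right],$$ where the supremum is taken over all pairs $(\varphi,\psi)$ of functions on $\mathbb{R}^d$ satisfying $\varphi(x)+\psi(y)\le\frac12|x-y|^2$ for all $x,y\in\mathbb{R}^d$, $\varphi(0)=\psi(0)=0$, and any one of the following regularity conditions (the identity holds for each of the four choices): (i) $\varphi,\psi:\mathbb{R}^d\to[-\infty,\infty)$ are lower semicontinuous; (ii) $\varphi,\psi\in C_2^2(\mathbb{R}^d)$; (iii) $\varphi,\psi\in C_2^2(\mathbb{R}^d)$ and both vanish on a neighbourhood of the origin; (iv) $\varphi,\psi\in C_b^2(\mathbb{R}^d)$ and both vanish on a neighbourhood of the origin.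
   Context: A L\'evy measure on $\mathbb{R}^n$ is a Borel measure $\mu$ with $\mu(\{0\})=0$ and $\int\min\{1,|x|^2\}\,d\mu<\infty$. $\Lambda_2(\mathbb{R}^d)$ is the set of L\'evy measures with $\int_{\mathbb{R}^d}|x|^2\,d\mu(x)<\infty$. For L\'evy measures $\mu,\nu$ on $\mathbb{R}^d$, $\Gamma^\Lambda(\mu,\nu)$ (the L\'evy couplings) is the set of L\'evy measures $\gamma$ on $\mathbb{R}^{2d}$ such that $\gamma(E\times\mathbb{R}^d)=\mu(E)$ and $\gamma(\mathbb{R}^d\times E)=\nu(E)$ for every Borel set $E\subset\mathbb{R}^d$ disjoint from some neighbourhood of $0$. The $2$-optimal L\'evy transport cost is $\mathcal{C}_2^\Lambda(\mu,\nu)=\inf_{\gamma\in\Gamma^\Lambda(\mu,\nu)}\int_{\mathbb{R}^{2d}}\frac12|x-y|^2\,d\gamma(x,y)$. $C_b^2(\mathbb{R}^d)$ is the space of bounded twice continuously differentiable functions, and $C_2^2(\mathbb{R}^d)$ the space of twice continuously differentiable functions with $|\varphi(x)|\le C(1+|x|^2)$ for some $C>0$. The integrals take values in $[-\infty,\infty)$ (the constraints force $\varphi(x),\psi(x)\le\frac12|x|^2$, so positive parts are integrable). *)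

theory Defs
  imports "HOL-Analysis.Analysis"
begin

definition levy_measure :: "'a::euclidean_space measure \<Rightarrow> bool" where
  "levy_measure M \<longleftrightarrow>
     sets M = sets borel \<and> emeasure M {0} = 0 \<and>
     (\<integral>\<^sup>+ x. ennreal (min 1 ((norm x)\<^sup>2)) \<partial>M) < \<infinity>"

definition Lambda2 :: "'a::euclidean_space measure set" where
  "Lambda2 = {M. levy_measure M \<and> (\<integral>\<^sup>+ x. ennreal ((norm x)\<^sup>2) \<partial>M) < \<infinity>}"

text \<open>The space of dimension \<open>2 d\<close> is the product type, whose norm is the Euclidean one. The total
  masses of the measures may be infinite and need not agree, which is why the marginals are only
  prescribed away from the origin.\<close>

definition levy_couplings ::
  "'a::euclidean_space measure \<Rightarrow> 'a measure \<Rightarrow> ('a \<times> 'a) measure set" where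
  "levy_couplings \<mu> \<nu> = {\<gamma>. levy_measure \<gamma> \<and>
     (\<forall>E \<in> sets borel. (\<exists>U. open U \<and> 0 \<in> U \<and> E \<inter> U = {}) \<longrightarrow>
        emeasure \<gamma> (E \<times> UNIV) = emeasure \<mu> E \<and>
        emeasure \<gamma> (UNIV \<times> E) = emeasure \<nu> E)}"

definition levy_cost :: "'a::euclidean_space measure \<Rightarrow> 'a measure \<Rightarrow> ennreal" where
  "levy_cost \<mu> \<nu> =
     (INF \<gamma> \<in> levy_couplings \<mu> \<nu>. \<integral>\<^sup>+ (x, y). ennreal (1/2 * (norm (x - y))\<^sup>2) \<partial>\<gamma>)"

text \<open>Integral of an extended real function as the integral of its positive part minus that of its
  negative part (\<open>e2ennreal\<close> sends negative values to \<open>0\<close>). It is meaningful, with a value in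
  \<open>[-\<infinity>, \<infinity>)\<close>, for measurable functions whose positive part has finite integral; this is the only
  case in which it is used below. For other functions the value is a junk value.\<close>

definition ereal_integral :: "'a measure \<Rightarrow> ('a \<Rightarrow> ereal) \<Rightarrow> ereal" where
  "ereal_integral M f =
     enn2ereal (\<integral>\<^sup>+ x. e2ennreal (f x) \<partial>M) - enn2ereal (\<integral>\<^sup>+ x. e2ennreal (- f x) \<partial>M)"

definition lsc :: "('a::topological_space \<Rightarrow> ereal) \<Rightarrow> bool" where
  "lsc f \<longleftrightarrow> (\<forall>t. open {x. t < f x})"

definition twice_cont_diff :: "('a::euclidean_space \<Rightarrow> real) \<Rightarrow> bool" where
  "twice_cont_diff f \<longleftrightarrow>
     (\<exists>(f' :: 'a \<Rightarrow> 'a \<Rightarrow>\<^sub>L real) (f'' :: 'a \<Rightarrow> 'a \<Rightarrow>\<^sub>L ('a \<Rightarrow>\<^sub>L real)).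
        (\<forall>x. (f has_derivative blinfun_apply (f' x)) (at x)) \<and>
        (\<forall>x. (f' has_derivative blinfun_apply (f'' x)) (at x)) \<and>
        continuous_on UNIV f'')"

definition C2_bounded :: "('a::euclidean_space \<Rightarrow> real) set" where
  "C2_bounded = {f. twice_cont_diff f \<and> bounded (range f)}"

definition C2_quadratic :: "('a::euclidean_space \<Rightarrow> real) set" where
  "C2_quadratic = {f. twice_cont_diff f \<and> (\<exists>C>0. \<forall>x. \<bar>f x\<bar> \<le> C * (1 + (norm x)\<^sup>2))}"

definition vanishes_near_0 :: "('a::euclidean_space \<Rightarrow> real) \<Rightarrow> bool" where
  "vanishes_near_0 f \<longleftrightarrow> (\<forall>\<^sub>F x in nhds 0. f x = 0)"

text \<open>The regularity classes, as sets of extended real functions. The class of lower semicontinuous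
  functions allows the value \<open>-\<infinity>\<close> but not \<open>\<infinity>\<close>, so that the sums below are never of
  the form \<open>\<infinity> + (-\<infinity>)\<close>.\<close>

definition class_lsc :: "('a::euclidean_space \<Rightarrow> ereal) set" where
  "class_lsc = {\<phi>. lsc \<phi> \<and> (\<forall>x. \<phi> x < \<infinity>)}"

definition class_C2_quadratic :: "('a::euclidean_space \<Rightarrow> ereal) set" where
  "class_C2_quadratic = {\<lambda>x. ereal (f x) | f. f \<in> C2_quadratic}"

definition class_C2_quadratic_vanishing :: "('a::euclidean_space \<Rightarrow> ereal) set" where
  "class_C2_quadratic_vanishing = {\<lambda>x. ereal (f x) | f. f \<in> C2_quadratic \<and> vanishes_near_0 f}"

definition class_C2_bounded_vanishing :: "('a::euclidean_space \<Rightarrow> ereal) set" where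
  "class_C2_bounded_vanishing = {\<lambda>x. ereal (f x) | f. f \<in> C2_bounded \<and> vanishes_near_0 f}"

definition admissible_pairs ::
  "('a::euclidean_space \<Rightarrow> ereal) set \<Rightarrow> (('a \<Rightarrow> ereal) \<times> ('a \<Rightarrow> ereal)) set" where
  "admissible_pairs F = {(\<phi>, \<psi>). \<phi> \<in> F \<and> \<psi> \<in> F \<and>
     (\<forall>x y. \<phi> x + \<psi> y \<le> ereal (1/2 * (norm (x - y))\<^sup>2)) \<and> \<phi> 0 = 0 \<and> \<psi> 0 = 0}"

definition dual_value ::
  "('a::euclidean_space \<Rightarrow> ereal) set \<Rightarrow> 'a measure \<Rightarrow> 'a measure \<Rightarrow> ereal" where
  "dual_value F \<mu> \<nu> =
     (SUP (\<phi>, \<psi>) \<in> admissible_pairs F. ereal_integral \<mu> \<phi> + ereal_integral \<nu> \<psi>)"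

end

theory Submission
  imports Defs
begin

text \<open>
  For each pair of admissible potentials and each coupling, integrating the constraint \<open>\<phi> x +
  \<psi> y \<le> |x - y|\<^sup>2 / 2\<close> gives \<open>\<integral> \<phi> d\<mu> + \<integral> \<psi> d\<nu> \<le> \<integral> |x - y|\<^sup>2 / 2 d\<gamma>\<close>; this is \<open>weak_duality\<close>,
  for lower semicontinuous potentials, the largest of the four classes. The classes form a
  chain (\<open>class_inclusions\<close>), so it remains to show that the cost is at most the supremum over
  the smallest class: bounded \<open>C\<^sup>2\<close> functions vanishing near 0 (\<open>levy_cost_le_dual_value\<close>).

  This is reduced to linear programming duality by one finite \<open>C\<^sup>2\<close> partition of unity
  (\<open>smooth_cells\<close>), which serves both problems. Fix a small \<open>\<delta>\<close> and a large \<open>R\<close>. The weights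
  live on small cells covering \<open>\<delta> \<le> |x| \<le> R\<close>, on a cell around the origin, and on the region
  beyond \<open>R\<close>. Consider the transport problem between the cells whose cost is a lower bound of
  \<open>|x - y|\<^sup>2 / 2\<close> on pairs of cells, whose marginals are the integrals of the weights, and in
  which the cell at the origin is a reservoir of unlimited mass.

  \<^item> Discrete potentials, used as coefficients of the weights, give functions that satisfy the
  constraint exactly, because both sides can be averaged with the weights
  (\<open>potential_admissible\<close>). They are smooth and bounded, and they vanish near 0 because only
  the reservoir lives there. So the discrete dual value is at most the dual value over the
  smallest class, up to a small error (\<open>cell_potentials_le_dual_value\<close>).

  \<^item> A discrete plan is realized by a coupling with an explicit density built from products of
  the weights, relative to the product of \<open>\<mu>\<close> and \<open>\<nu>\<close>, each enlarged by a unit mass at 0. So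
  the cost is at most the discrete cost, up to a small error (\<open>levy_cost_le_cell_plan\<close>).

  The finite problem is settled by Farkas' lemma (\<open>finite_transport_duality\<close>). Each of the two
  errors is at most \<open>\<integral> cell_error \<delta> R d\<mu> + \<integral> cell_error \<delta> R d\<nu>\<close>, which tends to 0 by dominated
  convergence since the second moments are finite (\<open>cell_error_integral_tendsto_0\<close>).
\<close>

section \<open>Farkas' lemma and finite transport with a reservoir\<close>

definition linear_functional :: "(('v \<Rightarrow> real) \<Rightarrow> real) \<Rightarrow> bool" where
  "linear_functional F \<longleftrightarrow> (\<forall>x y s. F (\<lambda>v. x v + s * y v) = F x + s * F y)"

lemma linear_functionalD:
  "linear_functional F \<Longrightarrow> F (\<lambda>v. x v + s * y v) = F x + s * F y"
  by (simp add: linear_functional_def)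

lemma linear_functional_zero: "linear_functional F \<Longrightarrow> F (\<lambda>v. 0) = 0"
  using linear_functionalD[of F "\<lambda>v. 0" 1 "\<lambda>v. 0"] by simp

lemma linear_functional_scale: "linear_functional F \<Longrightarrow> F (\<lambda>v. s * y v) = s * F y"
  using linear_functionalD[of F "\<lambda>v. 0" s y] by (simp add: linear_functional_zero)

text \<open>Farkas' lemma by Bartl's algebraic argument, an induction on the number of functionals. If a
  point \<open>y\<close> separates \<open>G\<close> from the old functionals, the new functional \<open>A m\<close> must be positive
  at \<open>y\<close>, so the hypothesis can be applied on the kernel of \<open>A m\<close>, onto which everything is
  projected along \<open>y\<close>.\<close>

lemma farkas:
  fixes A :: "'i \<Rightarrow> ('v \<Rightarrow> real) \<Rightarrow> real"
  assumes "finite I" and "\<And>i. i \<in> I \<Longrightarrow> linear_functional (A i)" and "linear_functional G"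
    and "\<And>x. (\<And>i. i \<in> I \<Longrightarrow> A i x \<le> 0) \<Longrightarrow> G x \<le> 0"
  shows "\<exists>l. (\<forall>i\<in>I. 0 \<le> l i) \<and> (\<forall>x. G x = (\<Sum>i\<in>I. l i * A i x))"
  using assms
proof (induction I arbitrary: A G rule: finite_induct)
  case empty
  have "G x = 0" for x
  proof -
    have "G (\<lambda>v. (-1) * x v) = - G x"
      by (subst linear_functional_scale[OF empty(2)]) simp
    moreover have "G x \<le> 0" "G (\<lambda>v. (-1) * x v) \<le> 0"
      using empty(3) by auto
    ultimately show ?thesis by linarith
  qed
  then show ?case by simp
next
  case (insert m I)
  show ?case
  proof (cases "\<forall>x. (\<forall>i\<in>I. A i x \<le> 0) \<longrightarrow> G x \<le> 0")
    case True
    then obtain l where l: "\<forall>i\<in>I. 0 \<le> l i" "\<forall>x. G x = (\<Sum>i\<in>I. l i * A i x)"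
      using insert.IH[of A G] insert.prems by auto
    have "(\<Sum>i\<in>insert m I. (l(m := 0)) i * A i x) = (\<Sum>i\<in>I. l i * A i x)" for x
      using insert.hyps by (auto intro!: sum.cong)
    then show ?thesis using l by (intro exI[of _ "l(m := 0)"]) auto
  next
    case False
    then obtain y where y: "\<And>i. i \<in> I \<Longrightarrow> A i y \<le> 0" "G y > 0" by force
    have Am: "A m y > 0" using insert.prems(3)[of y] y by force
    define z where "z = (\<lambda>v. (1 / A m y) * y v)"
    have Sc: "F z = F y / A m y" if "linear_functional F" for F
      unfolding z_def linear_functional_scale[OF that] by simp
    have z1: "A m z = 1" using Sc[OF insert.prems(1)[of m]] Am by simp
    have zi: "A i z \<le> 0" if "i \<in> I" for i
      using Sc[OF insert.prems(1)[of i]] y(1)[OF that] Am that by (simp add: divide_nonpos_pos)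
    have zG: "G z > 0" using Sc[OF insert.prems(2)] Am y(2) by simp
    define B where "B = (\<lambda>i x. A i x - A i z * A m x)"
    define H where "H = (\<lambda>x. G x - G z * A m x)"
    have lm: "linear_functional (A m)" using insert.prems by simp
    have lB: "linear_functional (B i)" if "i \<in> I" for i
      using insert.prems(1)[of i] lm that unfolding linear_functional_def B_def
      by (simp add: algebra_simps)
    have lH: "linear_functional H"
      using insert.prems(2) lm unfolding linear_functional_def H_def by (simp add: algebra_simps)
    have "H x \<le> 0" if x: "\<And>i. i \<in> I \<Longrightarrow> B i x \<le> 0" for x
    proof -
      \<comment> \<open>Moving \<open>x\<close> along \<open>z\<close> onto the kernel of the new functional.\<close>
      define x' where "x' = (\<lambda>v. x v + (- A m x) * z v)"
      have e: "F x' = F x - A m x * F z" if "linear_functional F" for F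
        unfolding x'_def linear_functionalD[OF that] by simp
      have "A i x' \<le> 0" if "i \<in> insert m I" for i
      proof (cases "i = m")
        case True then show ?thesis using e[OF lm] z1 by simp
      next
        case False
        then show ?thesis
          using that e[OF insert.prems(1)[of i]] x[of i] by (simp add: B_def mult.commute)
      qed
      then have "G x' \<le> 0" using insert.prems(3) by blast
      then show ?thesis using e[OF insert.prems(2)] by (simp add: H_def mult.commute)
    qed
    then obtain l where l: "\<forall>i\<in>I. 0 \<le> l i" "\<forall>x. H x = (\<Sum>i\<in>I. l i * B i x)"
      using insert.IH[of B H] lB lH by blast
    define c where "c = G z - (\<Sum>i\<in>I. l i * A i z)"
    have "(\<Sum>i\<in>I. l i * A i z) \<le> 0"
      using l(1) zi by (intro sum_nonpos) (simp add: mult_nonneg_nonpos)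
    then have c: "c \<ge> 0" using zG by (simp add: c_def)
    have "G x = (\<Sum>i\<in>insert m I. (l(m := c)) i * A i x)" for x
    proof -
      have "(\<Sum>i\<in>insert m I. (l(m := c)) i * A i x) = c * A m x + (\<Sum>i\<in>I. (l(m := c)) i * A i x)"
        using insert.hyps by simp
      also have "(\<Sum>i\<in>I. (l(m := c)) i * A i x) = (\<Sum>i\<in>I. l i * A i x)"
        using insert.hyps by (intro sum.cong) auto
      also have "\<dots> = H x + (\<Sum>i\<in>I. l i * A i z) * A m x"
        unfolding l(2)[rule_format] B_def
        by (simp add: algebra_simps sum_subtractf sum_distrib_left sum_distrib_right)
      finally show ?thesis by (simp add: H_def c_def algebra_simps)
    qed
    then show ?thesis using l(1) c insert.hyps by (intro exI[of _ "l(m := c)"]) auto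
  qed
qed

text \<open>The element \<open>r\<close> is a reservoir: it can absorb and emit any amount of mass, so only the
  marginals on \<open>I\<close> are prescribed, and dually both potentials vanish at \<open>r\<close>. The existence of
  a plan is Farkas' lemma for the constraints after adding a homogenizing variable \<open>t\<close> (the
  coordinate \<open>None\<close>): the multiplier of the constraint \<open>u i + v j \<le> t * k i j\<close> is the mass
  sent from \<open>i\<close> to \<open>j\<close>.\<close>

lemma finite_transport_duality:
  fixes a b :: "'i \<Rightarrow> real" and k :: "'i \<Rightarrow> 'i \<Rightarrow> real"
  assumes fin: "finite I" and r: "r \<notin> I"
    and a: "\<And>i. i \<in> I \<Longrightarrow> 0 \<le> a i" and b: "\<And>i. i \<in> I \<Longrightarrow> 0 \<le> b i"
    and D: "\<And>u v. u r = 0 \<Longrightarrow> v r = 0 \<Longrightarrow>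
          (\<And>i j. i \<in> insert r I \<Longrightarrow> j \<in> insert r I \<Longrightarrow> u i + v j \<le> k i j) \<Longrightarrow>
          (\<Sum>i\<in>I. a i * u i) + (\<Sum>j\<in>I. b j * v j) \<le> D"
  obtains p where "\<And>i j. i \<in> insert r I \<Longrightarrow> j \<in> insert r I \<Longrightarrow> 0 \<le> p i j"
    and "\<And>i. i \<in> I \<Longrightarrow> (\<Sum>j\<in>insert r I. p i j) = a i"
    and "\<And>j. j \<in> I \<Longrightarrow> (\<Sum>i\<in>insert r I. p i j) = b j"
    and "(\<Sum>i\<in>insert r I. \<Sum>j\<in>insert r I. p i j * k i j) \<le> D"
proof -
  let ?K = "insert r I"
  define L where "L = (\<lambda>(x :: ('i + 'i) option \<Rightarrow> real) i. if i = r then 0 else x (Some (Inl i)))"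
  define R where "R = (\<lambda>(x :: ('i + 'i) option \<Rightarrow> real) j. if j = r then 0 else x (Some (Inr j)))"
  define A where "A = (\<lambda>c x. case c of None \<Rightarrow> - x None
      | Some (i, j) \<Rightarrow> L x i + R x j - k i j * x None)"
  define G where "G = (\<lambda>x. (\<Sum>i\<in>I. a i * L x i) + (\<Sum>j\<in>I. b j * R x j) - D * x None)"
  define C where "C = insert None (Some ` (?K \<times> ?K))"
  have finC: "finite C" using fin by (simp add: C_def)
  have lA: "linear_functional (A c)" for c
    by (cases c) (auto simp: linear_functional_def A_def L_def R_def algebra_simps)
  have "L (\<lambda>w. x w + s * y w) i = L x i + s * L y i" "R (\<lambda>w. x w + s * y w) i = R x i + s * R y i"
    for x y s i by (auto simp: L_def R_def)
  then have lG: "linear_functional G"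
    unfolding linear_functional_def G_def
    by (simp add: algebra_simps sum.distrib sum_distrib_left)
  have cone: "G x \<le> 0" if x: "\<And>c. c \<in> C \<Longrightarrow> A c x \<le> 0" for x
  proof -
    define t where "t = x None"
    have t: "t \<ge> 0" using x[of None] by (simp add: C_def A_def t_def)
    have le: "L x i + R x j \<le> k i j * t" if "i \<in> ?K" "j \<in> ?K" for i j
    proof -
      have "Some (i, j) \<in> C" using that by (auto simp: C_def)
      from x[OF this] show ?thesis by (simp add: A_def t_def)
    qed
    have z: "L x r = 0" "R x r = 0" by (simp_all add: L_def R_def)
    show ?thesis
    proof (cases "t = 0")
      case True
      \<comment> \<open>At infinity (\<open>t = 0\<close>) the constraints against the reservoir force both potentials to be nonpositive.\<close>
      have "L x i \<le> 0" "R x i \<le> 0" if "i \<in> I" for i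
        using le[of i r] le[of r i] z True that by auto
      then have "(\<Sum>i\<in>I. a i * L x i) \<le> 0" "(\<Sum>i\<in>I. b i * R x i) \<le> 0"
        using a b by (auto intro!: sum_nonpos mult_nonneg_nonpos)
      then show ?thesis using True by (simp add: G_def t_def)
    next
      case False
      with t have t: "t > 0" by simp
      have "(\<Sum>i\<in>I. a i * (L x i / t)) + (\<Sum>j\<in>I. b j * (R x j / t)) \<le> D"
      proof (rule D)
        fix i j assume "i \<in> ?K" "j \<in> ?K"
        then show "L x i / t + R x j / t \<le> k i j"
          using le[of i j] t by (simp add: field_simps)
      qed (use z in auto)
      then have "((\<Sum>i\<in>I. a i * L x i) + (\<Sum>j\<in>I. b j * R x j)) / t \<le> D"
        by (simp add: add_divide_distrib sum_divide_distrib)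
      then show ?thesis using t by (simp add: G_def t_def field_simps)
    qed
  qed
  have "\<exists>l. (\<forall>c\<in>C. 0 \<le> l c) \<and> (\<forall>x. G x = (\<Sum>c\<in>C. l c * A c x))"
    by (rule farkas[OF finC lA lG cone])
  then obtain l where l: "\<And>c. c \<in> C \<Longrightarrow> 0 \<le> l c" and Gl: "\<And>x. G x = (\<Sum>c\<in>C. l c * A c x)"
    by blast
  define p where "p = (\<lambda>i j. l (Some (i, j)))"
  have G: "G x = (\<Sum>i\<in>?K. \<Sum>j\<in>?K. p i j * (L x i + R x j - k i j * x None)) - l None * x None" for x
  proof -
    have "(\<Sum>c\<in>C. l c * A c x) = (\<Sum>c\<in>Some ` (?K \<times> ?K). l c * A c x) - l None * x None"
      unfolding C_def using fin by (subst sum.insert) (auto simp: A_def)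
    also have "(\<Sum>c\<in>Some ` (?K \<times> ?K). l c * A c x)
        = (\<Sum>(i, j)\<in>?K \<times> ?K. p i j * (L x i + R x j - k i j * x None))"
      by (subst sum.reindex) (auto simp: p_def A_def intro!: sum.cong)
    finally show ?thesis unfolding Gl sum.cartesian_product .
  qed
  show thesis
  proof (rule that[of p])
    show "0 \<le> p i j" if "i \<in> ?K" "j \<in> ?K" for i j
      using l[of "Some (i, j)"] that by (auto simp: p_def C_def)
    show "(\<Sum>j\<in>?K. p i j) = a i" if i: "i \<in> I" for i
    proof -
      \<comment> \<open>Comparing coefficients: evaluation at a unit vector.\<close>
      let ?x = "\<lambda>v. if v = Some (Inl i) then 1 else 0 :: real"
      have Lx: "L ?x i' = (if i' = i then 1 else 0)" for i' using i r by (auto simp: L_def)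
      have Rx: "R ?x i' = 0" for i' by (auto simp: R_def)
      have "G ?x = a i" unfolding G_def Lx Rx using i fin by (simp add: if_distrib cong: if_cong)
      moreover have "G ?x = (\<Sum>i'\<in>?K. \<Sum>j\<in>?K. if i' = i then p i j else 0)"
        unfolding G Lx Rx by (auto intro!: sum.cong)
      moreover have "\<dots> = (\<Sum>i'\<in>?K. if i' = i then \<Sum>j\<in>?K. p i j else 0)"
        by (intro sum.cong) auto
      moreover have "\<dots> = (\<Sum>j\<in>?K. p i j)" using i fin by simp
      ultimately show ?thesis by simp
    qed
    show "(\<Sum>i\<in>?K. p i j) = b j" if j: "j \<in> I" for j
    proof -
      let ?x = "\<lambda>v. if v = Some (Inr j) then 1 else 0 :: real"
      have Rx: "R ?x i' = (if i' = j then 1 else 0)" for i' using j r by (auto simp: R_def)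
      have Lx: "L ?x i' = 0" for i' by (auto simp: L_def)
      have "G ?x = b j" unfolding G_def Lx Rx using j fin by (simp add: if_distrib cong: if_cong)
      moreover have "G ?x = (\<Sum>i\<in>?K. \<Sum>j'\<in>?K. if j' = j then p i j else 0)"
        unfolding G Lx Rx by (auto intro!: sum.cong)
      moreover have "\<dots> = (\<Sum>i\<in>?K. p i j)"
        using j fin by (intro sum.cong) (auto simp: sum.delta simp del: sum.insert)
      ultimately show ?thesis by simp
    qed
    show "(\<Sum>i\<in>?K. \<Sum>j\<in>?K. p i j * k i j) \<le> D"
    proof -
      let ?x = "\<lambda>v. if v = None then 1 else 0 :: real"
      have 0: "L ?x i = 0" "R ?x i = 0" for i by (auto simp: L_def R_def)
      have "- D = - (\<Sum>i\<in>?K. \<Sum>j\<in>?K. p i j * k i j) - l None"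
        using G[of ?x] unfolding G_def 0 by (simp add: sum_negf del: sum.insert)
      then show ?thesis using l[of None] by (simp add: C_def)
    qed
  qed
qed

section \<open>Calculus of twice continuously differentiable functions\<close>

lemma twice_cont_diffI:
  fixes f :: "'a::euclidean_space \<Rightarrow> real"
  assumes "\<And>x. (f has_derivative blinfun_apply (f' x)) (at x)"
    and "\<And>x. (f' has_derivative blinfun_apply (f'' x)) (at x)"
    and "continuous_on UNIV f''"
  shows "twice_cont_diff f"
  using assms unfolding twice_cont_diff_def by blast

lemma twice_cont_diff_continuous:
  assumes "twice_cont_diff f" shows "continuous_on UNIV f"
  using assms has_derivative_continuous
  unfolding twice_cont_diff_def continuous_on_eq_continuous_within by blast

lemma twice_cont_diff_const: "twice_cont_diff (\<lambda>x. c)"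
  by (rule twice_cont_diffI[where f' = "\<lambda>_. 0" and f'' = "\<lambda>_. 0"]) (auto simp: zero_blinfun.rep_eq)

lemma twice_cont_diff_add:
  assumes "twice_cont_diff f" "twice_cont_diff g"
  shows "twice_cont_diff (\<lambda>x. f x + g x)"
proof -
  obtain f' f'' g' g'' where
    "\<And>x. (f has_derivative blinfun_apply (f' x)) (at x)"
    "\<And>x. (f' has_derivative blinfun_apply (f'' x)) (at x)" "continuous_on UNIV f''"
    "\<And>x. (g has_derivative blinfun_apply (g' x)) (at x)"
    "\<And>x. (g' has_derivative blinfun_apply (g'' x)) (at x)" "continuous_on UNIV g''"
    using assms unfolding twice_cont_diff_def by blast
  then show ?thesis
    by (intro twice_cont_diffI[where f' = "\<lambda>x. f' x + g' x" and f'' = "\<lambda>x. f'' x + g'' x"])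
      (auto simp: plus_blinfun.rep_eq intro!: has_derivative_add continuous_on_add)
qed

text \<open>The chain rule twice. Together with sums this yields products and quotients, hence the
  smooth partition of unity below; \<open>p\<close> has to be differentiable only on the range of \<open>f\<close>,
  which admits \<open>p = inverse\<close> for positive \<open>f\<close>.\<close>

lemma twice_cont_diff_compose:
  fixes f :: "'a::euclidean_space \<Rightarrow> real"
  assumes f: "twice_cont_diff f"
    and p: "\<And>x. (p has_real_derivative p' (f x)) (at (f x))"
    and p': "\<And>x. (p' has_real_derivative p'' (f x)) (at (f x))"
    and p'': "continuous_on (range f) p''"
  shows "twice_cont_diff (\<lambda>x. p (f x))"
proof -
  obtain f' f'' where
    f': "\<And>x. (f has_derivative blinfun_apply (f' x)) (at x)" and
    f'': "\<And>x. (f' has_derivative blinfun_apply (f'' x)) (at x)" and cf'': "continuous_on UNIV f''"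
    using f unfolding twice_cont_diff_def by blast
  have cf: "continuous_on UNIV f" by (rule twice_cont_diff_continuous[OF f])
  have cf': "continuous_on UNIV f'"
    using f'' has_derivative_continuous unfolding continuous_on_eq_continuous_within by blast
  have d: "((\<lambda>x. q (f x)) has_derivative (\<lambda>h. q' (f x) * f' x h)) (at x)"
    if "\<And>x. (q has_real_derivative q' (f x)) (at (f x))" for q q' x
  proof -
    have "(q has_derivative ((*) (q' (f x)))) (at (f x))"
      using that[of x] by (simp add: has_field_derivative_def)
    from has_derivative_compose[OF f' this] show ?thesis .
  qed
  have cp': "continuous_on UNIV (\<lambda>x. p' (f x))"
    using d[OF p'] has_derivative_continuous unfolding continuous_on_eq_continuous_within by blast
  have cp'': "continuous_on UNIV (\<lambda>x. p'' (f x))"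
    using continuous_on_compose2[OF p'' cf] by simp
  show ?thesis
  proof (rule twice_cont_diffI[where f' = "\<lambda>x. p' (f x) *\<^sub>R f' x" and
        f'' = "\<lambda>x. p' (f x) *\<^sub>R f'' x + (blinfun_scaleR_left (f' x) o\<^sub>L (p'' (f x) *\<^sub>R f' x))"])
    fix x
    show "((\<lambda>x. p (f x)) has_derivative blinfun_apply (p' (f x) *\<^sub>R f' x)) (at x)"
      using d[OF p, of x] by (simp add: scaleR_blinfun.rep_eq)
    have "((\<lambda>x. p' (f x) *\<^sub>R f' x) has_derivative
        (\<lambda>h. p' (f x) *\<^sub>R f'' x h + (p'' (f x) * f' x h) *\<^sub>R f' x)) (at x)"
      by (rule has_derivative_scaleR[OF d[OF p'] f''])
    moreover have "(\<lambda>h. p' (f x) *\<^sub>R f'' x h + (p'' (f x) * f' x h) *\<^sub>R f' x)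
      = blinfun_apply (p' (f x) *\<^sub>R f'' x + (blinfun_scaleR_left (f' x) o\<^sub>L (p'' (f x) *\<^sub>R f' x)))"
      by (auto simp: fun_eq_iff plus_blinfun.rep_eq scaleR_blinfun.rep_eq)
    ultimately show "((\<lambda>x. p' (f x) *\<^sub>R f' x) has_derivative blinfun_apply (p' (f x) *\<^sub>R f'' x +
        (blinfun_scaleR_left (f' x) o\<^sub>L (p'' (f x) *\<^sub>R f' x)))) (at x)" by simp
  next
    show "continuous_on UNIV (\<lambda>x. p' (f x) *\<^sub>R f'' x +
        (blinfun_scaleR_left (f' x) o\<^sub>L (p'' (f x) *\<^sub>R f' x)))"
      by (intro continuous_intros cp' cp'' cf' cf'')
  qed
qed

lemma twice_cont_diff_cmult:
  assumes "twice_cont_diff f" shows "twice_cont_diff (\<lambda>x. c * f x)"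
  by (rule twice_cont_diff_compose[OF assms, of "\<lambda>t. c * t" "\<lambda>_. c" "\<lambda>_. 0"])
    (auto intro!: derivative_eq_intros)

text \<open>Polarization reduces products to squares, that is, to composition with \<open>t\<^sup>2\<close>.\<close>

lemma twice_cont_diff_mult:
  assumes "twice_cont_diff f" "twice_cont_diff g"
  shows "twice_cont_diff (\<lambda>x. f x * g x)"
proof -
  have sq: "twice_cont_diff (\<lambda>x. (h x)\<^sup>2)" if "twice_cont_diff h" for h :: "'a \<Rightarrow> real"
    by (rule twice_cont_diff_compose[OF that, of "\<lambda>t. t\<^sup>2" "\<lambda>t. 2 * t" "\<lambda>_. 2"])
      (auto intro!: derivative_eq_intros)
  have "twice_cont_diff (\<lambda>x. 1/4 * (f x + g x)\<^sup>2 + (-1/4) * (f x + (-1) * g x)\<^sup>2)"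
    by (intro twice_cont_diff_add twice_cont_diff_cmult sq assms)
  also have "(\<lambda>x. 1/4 * (f x + g x)\<^sup>2 + (-1/4) * (f x + (-1) * g x)\<^sup>2) = (\<lambda>x. f x * g x)"
    by (auto simp: fun_eq_iff power2_eq_square algebra_simps)
  finally show ?thesis .
qed

lemma twice_cont_diff_divide:
  assumes "twice_cont_diff f" "twice_cont_diff g" "\<And>x. 0 < g x"
  shows "twice_cont_diff (\<lambda>x. f x / g x)"
proof -
  have "twice_cont_diff (\<lambda>x. inverse (g x))"
  proof (rule twice_cont_diff_compose[OF assms(2), where p' = "\<lambda>t. - inverse (t^2)"
        and p'' = "\<lambda>t. 2 * inverse (t^3)"])
    fix x have "g x \<noteq> 0" using assms(3)[of x] by simp
    then show "(inverse has_real_derivative - inverse ((g x)\<^sup>2)) (at (g x))"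
      "((\<lambda>t. - inverse (t^2)) has_real_derivative 2 * inverse ((g x)^3)) (at (g x))"
      by (auto intro!: derivative_eq_intros simp: field_simps power2_eq_square power3_eq_cube)
  next
    show "continuous_on (range g) (\<lambda>t. 2 * inverse (t ^ 3))"
      using assms(3) by (intro continuous_intros) (metis less_irrefl power_eq_0_iff rangeE)
  qed
  from twice_cont_diff_mult[OF assms(1) this] show ?thesis by (simp add: divide_inverse)
qed

lemma twice_cont_diff_sum:
  assumes "\<And>i. i \<in> I \<Longrightarrow> twice_cont_diff (f i)"
  shows "twice_cont_diff (\<lambda>x. \<Sum>i\<in>I. f i x)"
  using assms
  by (induction I rule: infinite_finite_induct)
    (auto intro: twice_cont_diff_const twice_cont_diff_add)

lemma twice_cont_diff_dist_square:
  "twice_cont_diff (\<lambda>x :: 'a::euclidean_space. (norm (x - a))\<^sup>2)"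
proof (rule twice_cont_diffI[where f' = "\<lambda>x. 2 *\<^sub>R blinfun_inner_right (x - a)"
      and f'' = "\<lambda>_. 2 *\<^sub>R Blinfun blinfun_inner_right"])
  fix x
  show "((\<lambda>x. (norm (x - a))\<^sup>2) has_derivative blinfun_apply (2 *\<^sub>R blinfun_inner_right (x - a))) (at x)"
    unfolding power2_norm_eq_inner
    by (auto intro!: derivative_eq_intros simp: scaleR_blinfun.rep_eq inner_commute)
  show "((\<lambda>x. 2 *\<^sub>R blinfun_inner_right (x - a)) has_derivative
      blinfun_apply (2 *\<^sub>R Blinfun blinfun_inner_right)) (at x)"
    by (auto intro!: derivative_eq_intros bounded_linear.has_derivative[OF bounded_linear_blinfun_inner_right] simp: scaleR_blinfun.rep_eq fun_eq_iff
        bounded_linear_Blinfun_apply[OF bounded_linear_blinfun_inner_right])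
qed auto

text \<open>The cube is the lowest power of the positive part that is twice continuously differentiable.\<close>

lemma twice_cont_diff_pos_part_cube:
  assumes "twice_cont_diff f"
  shows "twice_cont_diff (\<lambda>x. (max 0 (f x)) ^ 3)"
proof (rule twice_cont_diff_compose[OF assms, where p = "\<lambda>t. (max 0 t) ^ 3"
      and p' = "\<lambda>t. 3 * (max 0 t)\<^sup>2" and p'' = "\<lambda>t. 6 * max 0 t"])
  have d: "((\<lambda>t. (max 0 t) ^ Suc (Suc n)) has_real_derivative real (Suc (Suc n)) * (max 0 t) ^ Suc n) (at t)" for t :: real and n
  proof -
    consider "t < 0" | "t > 0" | "t = 0" by linarith
    then show ?thesis
    proof cases
      case 1
      have "((\<lambda>t. 0) has_real_derivative 0) (at t)" by simp
      then have "((\<lambda>t. (max 0 t) ^ Suc (Suc n)) has_real_derivative 0) (at t)"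
        by (rule has_field_derivative_transform_within_open[where S = "{..<0}"]) (use 1 in auto)
      then show ?thesis using 1 by simp
    next
      case 2
      have "((\<lambda>t. t ^ Suc (Suc n)) has_real_derivative real (Suc (Suc n)) * t ^ Suc n) (at t)"
        using DERIV_pow[of "Suc (Suc n)" t] by simp
      then have "((\<lambda>t. (max 0 t) ^ Suc (Suc n)) has_real_derivative real (Suc (Suc n)) * t ^ Suc n) (at t)"
        by (rule has_field_derivative_transform_within_open[where S = "{0<..}"]) (use 2 in auto)
      then show ?thesis using 2 by simp
    next
      case 3
      have "((\<lambda>y::real. ((max 0 y) ^ Suc (Suc n) - (max 0 0) ^ Suc (Suc n)) / (y - 0)) \<longlongrightarrow> 0) (at 0)"
      proof (rule Lim_null_comparison)
        show "\<forall>\<^sub>F y in at 0. norm (((max 0 y) ^ Suc (Suc n) - (max 0 0) ^ Suc (Suc n)) / (y - 0)) \<le> (max 0 y :: real) ^ Suc n"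
          by (auto simp: eventually_at_filter max_def)
        have "((\<lambda>y::real. (max 0 y) ^ Suc n) \<longlongrightarrow> (max 0 0) ^ Suc n) (at 0)"
          by (intro tendsto_intros)
        then show "((\<lambda>y::real. (max 0 y) ^ Suc n) \<longlongrightarrow> 0) (at 0)" by simp
      qed
      then show ?thesis using 3 by (simp add: has_field_derivative_iff)
    qed
  qed
  fix x
  show "((\<lambda>t. (max 0 t) ^ 3) has_real_derivative 3 * (max 0 (f x))\<^sup>2) (at (f x))"
    using d[of 1 "f x"] by (simp add: numeral_eq_Suc)
  show "((\<lambda>t. 3 * (max 0 t)\<^sup>2) has_real_derivative 6 * max 0 (f x)) (at (f x))"
    using DERIV_cmult[OF d[of 0 "f x"], of 3] by (simp add: numeral_eq_Suc)
qed (auto intro!: continuous_intros)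

section \<open>Smooth cells and spread potentials\<close>

text \<open>The cells are balls around finitely many centres. The cell at the origin is the large one
  and plays the part of the reservoir.\<close>

definition cell_radius :: "real \<Rightarrow> 'a::euclidean_space \<Rightarrow> real" where
  "cell_radius \<delta> z = (if z = 0 then 2 * \<delta> else \<delta> / 4)"

text \<open>A lower bound of the transport cost between any point of the cell of \<open>z\<close> and any point of
  the cell of \<open>z'\<close>, so that discrete potentials feasible for it remain feasible when they are
  spread over the cells.\<close>

definition cell_cost :: "real \<Rightarrow> 'a::euclidean_space \<Rightarrow> 'a \<Rightarrow> real" where
  "cell_cost \<delta> z z' = 1/2 * (max 0 (norm (z - z') - cell_radius \<delta> z - cell_radius \<delta> z'))\<^sup>2"

text \<open>What replacing the transport cost by \<open>cell_cost\<close> loses, charged to a single point; in the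
  region beyond \<open>R\<close>, the cost of moving the point to the origin. It is dominated by \<open>9 |x|\<^sup>2\<close>
  and tends to 0 pointwise for \<open>\<delta> \<rightarrow> 0\<close>, \<open>R \<rightarrow> \<infinity>\<close>. The first part needs both entries of the
  minimum: \<open>4 \<delta> |x|\<close> makes it small, but need not be integrable near the origin; \<open>8 |x|\<^sup>2\<close> is
  integrable.\<close>

definition cell_error :: "real \<Rightarrow> real \<Rightarrow> 'a::euclidean_space \<Rightarrow> real" where
  "cell_error \<delta> R x = min (4 * \<delta> * norm x) (8 * (norm x)\<^sup>2) + (if R < norm x then (norm x)\<^sup>2 / 2 else 0)"

text \<open>A partition of unity: \<open>w z\<close> lives on the cell of \<open>z\<close>, and \<open>w'\<close> outside the ball of radius
  \<open>R\<close>. The centres other than 0 keep a distance \<open>\<delta>\<close> from the origin while their cells have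
  radius \<open>\<delta> / 4\<close>; hence near the origin only \<open>w 0\<close> is nonzero.\<close>

locale smooth_cells =
  fixes \<delta> R :: real and I :: "'a::euclidean_space set" and w :: "'a \<Rightarrow> 'a \<Rightarrow> real" and w' :: "'a \<Rightarrow> real"
  assumes delta: "0 < \<delta>" "\<delta> < R"
    and fin: "finite I" and centre: "\<And>z. z \<in> I \<Longrightarrow> \<delta> \<le> norm z \<and> norm z \<le> R"
    and smooth: "\<And>z. twice_cont_diff (w z)" "twice_cont_diff w'"
    and nonneg: "\<And>z x. 0 \<le> w z x" "\<And>x. 0 \<le> w' x"
    and sum_eq_1: "\<And>x. (\<Sum>z\<in>insert 0 I. w z x) + w' x = 1"
    and support: "\<And>z x. 0 < w z x \<Longrightarrow> norm (x - z) < cell_radius \<delta> z"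
    and support': "\<And>x. 0 < w' x \<Longrightarrow> R < norm x"

text \<open>Finitely many balls of radius \<open>\<delta> / 4\<close> cover the compact shell \<open>\<delta> \<le> |x| \<le> R\<close>. Cubes of
  positive parts of quadratic functions give \<open>C\<^sup>2\<close> functions that are positive exactly on the
  cells, and dividing them by their sum gives the weights.\<close>

lemma smooth_cells_exist:
  assumes "0 < \<delta>" "\<delta> < R"
  shows "\<exists>I (w :: 'a::euclidean_space \<Rightarrow> 'a \<Rightarrow> real) w'. smooth_cells \<delta> R I w w'"
proof -
  let ?K = "{x :: 'a. \<delta> \<le> norm x} \<inter> cball 0 R"
  have "closed {x :: 'a. \<delta> \<le> norm x}" by (intro closed_Collect_le continuous_intros)
  then have "compact ?K" by (rule closed_Int_compact) simp
  then have "\<exists>I. finite I \<and> I \<subseteq> ?K \<and> ?K \<subseteq> (\<Union>z\<in>I. ball z (\<delta> / 4))"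
    using assms(1) by (intro seq_compact_imp_totally_bounded[rule_format] compact_imp_seq_compact) auto
  then obtain I where I: "finite I" "I \<subseteq> ?K" "?K \<subseteq> (\<Union>z\<in>I. ball z (\<delta> / 4))" by blast
  define c where "c = (\<lambda>z x :: 'a. (max 0 ((cell_radius \<delta> z)\<^sup>2 + (-1) * (norm (x - z))\<^sup>2)) ^ 3)"
  define c' where "c' = (\<lambda>x :: 'a. (max 0 ((norm (x - 0))\<^sup>2 + (- (R\<^sup>2)))) ^ 3)"
  define S where "S = (\<lambda>x. (\<Sum>z\<in>insert 0 I. c z x) + c' x)"
  have rad: "cell_radius \<delta> z > 0" for z :: 'a using assms by (simp add: cell_radius_def)
  have c0: "0 \<le> c z x" "0 \<le> c' x" for z x by (simp_all add: c_def c'_def)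
  have cpos: "0 < c z x \<longleftrightarrow> norm (x - z) < cell_radius \<delta> z" for z x
  proof -
    have "0 < c z x \<longleftrightarrow> (norm (x - z))\<^sup>2 < (cell_radius \<delta> z)\<^sup>2"
      by (auto simp: c_def max_def zero_less_power_eq)
    also have "\<dots> \<longleftrightarrow> norm (x - z) < cell_radius \<delta> z"
      using rad[of z] power_strict_mono[of "norm (x - z)" "cell_radius \<delta> z" 2]
        power_less_imp_less_base[of "norm (x - z)" 2 "cell_radius \<delta> z"] by auto
    finally show ?thesis .
  qed
  have cpos': "0 < c' x \<longleftrightarrow> R < norm x" for x
  proof -
    have "0 < c' x \<longleftrightarrow> R\<^sup>2 < (norm x)\<^sup>2"
      by (auto simp: c'_def max_def zero_less_power_eq)
    also have "\<dots> \<longleftrightarrow> R < norm x"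
      using assms power_strict_mono[of R "norm x" 2] power_less_imp_less_base[of R 2 "norm x"] by auto
    finally show ?thesis .
  qed
  have S: "0 < S x" for x
  proof -
    consider "norm x < 2 * \<delta>" | "R < norm x" | "x \<in> ?K" using assms by force
    then have "0 < c' x \<or> (\<exists>z\<in>insert 0 I. 0 < c z x)"
    proof cases
      case 1 then show ?thesis by (simp add: cpos cell_radius_def)
    next
      case 2 then show ?thesis by (simp add: cpos')
    next
      case 3
      then obtain z where z: "z \<in> I" "norm (x - z) < \<delta> / 4"
        using I(3) by (auto simp: dist_norm norm_minus_commute)
      moreover have "z \<noteq> 0" using z I(2) assms by auto
      ultimately have "0 < c z x" using assms by (simp add: cpos cell_radius_def)
      then show ?thesis using z by auto
    qed
    moreover have "0 \<le> (\<Sum>z\<in>insert 0 I. c z x)" by (intro sum_nonneg c0)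
    moreover have "0 < (\<Sum>z\<in>insert 0 I. c z x)" if "\<exists>z\<in>insert 0 I. 0 < c z x"
      using that c0 I(1) by (meson finite_insert sum_pos2)
    ultimately show ?thesis using c0(2)[of x] unfolding S_def by (meson add_nonneg_pos add_pos_nonneg)
  qed
  have tc: "twice_cont_diff (c z)" "twice_cont_diff c'" for z
    unfolding c_def c'_def
    by (intro twice_cont_diff_pos_part_cube twice_cont_diff_add twice_cont_diff_cmult
        twice_cont_diff_const twice_cont_diff_dist_square)+
  have tS: "twice_cont_diff S"
    unfolding S_def by (intro twice_cont_diff_add twice_cont_diff_sum tc)
  have "smooth_cells \<delta> R I (\<lambda>z x. c z x / S x) (\<lambda>x. c' x / S x)"
  proof
    show "(\<Sum>z\<in>insert 0 I. c z x / S x) + c' x / S x = 1" for x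
    proof -
      have "S x = (\<Sum>z\<in>insert 0 I. c z x) + c' x" by (simp only: S_def)
      then show ?thesis using S[of x]
        by (simp add: sum_divide_distrib[symmetric] add_divide_distrib[symmetric] del: sum.insert)
    qed
    show "norm (x - z) < cell_radius \<delta> z" if "0 < c z x / S x" for z x
      using that S[of x] by (simp add: cpos zero_less_divide_iff)
    show "R < norm x" if "0 < c' x / S x" for x
      using that S[of x] by (simp add: cpos' zero_less_divide_iff)
    show "twice_cont_diff (\<lambda>x. c z x / S x)" "twice_cont_diff (\<lambda>x. c' x / S x)" for z
      by (intro twice_cont_diff_divide tc tS S)+
    show "0 \<le> c z x / S x" "0 \<le> c' x / S x" for z x
      using c0 S[of x] by (simp_all add: less_imp_le)
  qed (use assms I in auto)
  then show ?thesis by blast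
qed

lemma cell_cost_nonneg: "0 \<le> cell_cost \<delta> z z'"
  by (simp add: cell_cost_def)

lemma cell_cost_le:
  assumes "norm (x - z) < cell_radius \<delta> z" "norm (y - z') < cell_radius \<delta> z'"
  shows "cell_cost \<delta> z z' \<le> 1/2 * (norm (x - y))\<^sup>2"
proof -
  have "norm (z - z') \<le> norm (x - z) + norm (x - y) + norm (y - z')" by norm
  then have "max 0 (norm (z - z') - cell_radius \<delta> z - cell_radius \<delta> z') \<le> norm (x - y)"
    using assms by auto
  then show ?thesis unfolding cell_cost_def by (intro mult_left_mono power_mono) auto
qed

text \<open>How much the cost can exceed the cell cost if the distance \<open>s\<close> exceeds the distance \<open>d\<close> of
  the cells by at most \<open>e\<close>. The excess is linear in \<open>s\<close>, and \<open>s \<le> |x| + |y|\<close> splits it between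
  the two points.\<close>

lemma half_square_le:
  fixes s d e :: real
  assumes "s \<le> max 0 d + e" "0 \<le> s" "0 \<le> e"
  shows "1/2 * s\<^sup>2 \<le> 1/2 * (max 0 d)\<^sup>2 + e * s"
proof (cases "s \<le> max 0 d")
  case True
  then have "s\<^sup>2 \<le> (max 0 d)\<^sup>2" using assms by (intro power_mono) auto
  moreover have "0 \<le> e * s" using assms by simp
  ultimately show ?thesis by linarith
next
  case False
  define m where "m = max 0 d"
  have "(s - m) * (s + m) \<le> e * (2 * s)"
    using False assms by (intro mult_mono) (auto simp: m_def)
  then show ?thesis unfolding m_def[symmetric] by (simp add: power2_eq_square algebra_simps)
qed

lemma cell_error_nonneg: "0 \<le> \<delta> \<Longrightarrow> 0 \<le> cell_error \<delta> R x"
  by (simp add: cell_error_def)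

lemma cell_error_0 [simp]: "0 \<le> R \<Longrightarrow> cell_error \<delta> R 0 = 0"
  by (simp add: cell_error_def)

lemma cell_error_bound: "cell_error \<delta> R x \<le> 9 * (norm x)\<^sup>2"
proof -
  have "min (4 * \<delta> * norm x) (8 * (norm x)\<^sup>2) \<le> 8 * (norm x)\<^sup>2" by simp
  then show ?thesis using zero_le_power2[of "norm x"] unfolding cell_error_def
    by (cases "R < norm x"; simp only: if_True if_False; linarith)
qed

lemma cell_error_ge:
  assumes "\<delta> \<le> 2 * norm x" "0 \<le> \<delta>"
  shows "4 * \<delta> * norm x \<le> cell_error \<delta> R x"
proof -
  have "(4 * \<delta>) * norm x \<le> (8 * norm x) * norm x" using assms by (intro mult_right_mono) auto
  then show ?thesis by (simp add: cell_error_def power2_eq_square)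
qed

lemma cell_error_ge_small:
  assumes "norm x < 2 * \<delta>" shows "(norm x)\<^sup>2 / 2 \<le> cell_error \<delta> R x"
proof -
  have "norm x * norm x \<le> (2 * \<delta>) * norm x" using assms by (intro mult_right_mono) auto
  moreover have "0 \<le> \<delta> * norm x" using assms norm_ge_zero[of x] by (intro mult_nonneg_nonneg) linarith+
  ultimately show ?thesis by (auto simp: cell_error_def power2_eq_square min_def)
qed

lemma cell_error_ge_large:
  assumes "R < norm x" "0 \<le> \<delta>" shows "(norm x)\<^sup>2 / 2 \<le> cell_error \<delta> R x"
  using assms by (simp add: cell_error_def)

lemma cell_error_measurable [measurable]: "cell_error \<delta> R \<in> borel_measurable borel"
  unfolding cell_error_def[abs_def] by measurable

context smooth_cells
begin

lemma centre_nz: "z \<in> I \<Longrightarrow> z \<noteq> 0" "0 \<notin> I"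
  using centre delta by force+

lemma support_cell:
  assumes "z \<in> I" "0 < w z x" shows "norm (x - z) < \<delta> / 4" "3/4 * \<delta> < norm x"
proof -
  show "norm (x - z) < \<delta> / 4" using support[OF assms(2)] centre_nz(1)[OF assms(1)] by (simp add: cell_radius_def)
  moreover have "norm z \<le> norm (x - z) + norm x" by norm
  ultimately show "3/4 * \<delta> < norm x" using centre[OF assms(1)] by linarith
qed

lemma cost_le_cell_cost:
  assumes "z \<in> I" "0 < w z x" "z' \<in> I" "0 < w z' y"
  shows "1/2 * (norm (x - y))\<^sup>2 \<le> cell_cost \<delta> z z' + (cell_error \<delta> R x + cell_error \<delta> R y)"
proof -
  note s = support_cell[OF assms(1,2)] support_cell[OF assms(3,4)]
  have "norm (x - y) \<le> norm (x - z) + norm (z - z') + norm (y - z')" by norm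
  then have "norm (x - y) \<le> max 0 (norm (z - z') - \<delta>/4 - \<delta>/4) + \<delta>"
    using s delta by auto
  from half_square_le[OF this] have "1/2 * (norm (x - y))\<^sup>2 \<le> cell_cost \<delta> z z' + \<delta> * norm (x - y)"
    using delta centre_nz(1) assms by (simp add: cell_cost_def cell_radius_def)
  also have "\<delta> * norm (x - y) \<le> \<delta> * (norm x + norm y)"
    using delta norm_triangle_ineq4[of x y] by simp
  also have "\<dots> \<le> 4 * \<delta> * norm x + 4 * \<delta> * norm y"
    using delta by (simp add: algebra_simps)
  also have "\<dots> \<le> cell_error \<delta> R x + cell_error \<delta> R y"
    using s delta by (intro add_mono cell_error_ge) auto
  finally show ?thesis by simp
qed

lemma cost_le_cell_cost_0:
  assumes "z \<in> I" "0 < w z x"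
  shows "1/2 * (norm x)\<^sup>2 \<le> cell_cost \<delta> z 0 + cell_error \<delta> R x"
    and "1/2 * (norm x)\<^sup>2 \<le> cell_cost \<delta> 0 z + cell_error \<delta> R x"
proof -
  note s = support_cell[OF assms]
  have "norm x \<le> norm (x - z) + norm z" by norm
  then have "norm x \<le> max 0 (norm z - \<delta>/4 - 2 * \<delta>) + 4 * \<delta>"
    using s delta by auto
  from half_square_le[OF this] have *: "1/2 * (norm x)\<^sup>2 \<le> cell_cost \<delta> z 0 + 4 * \<delta> * norm x"
    using delta centre_nz(1) assms by (simp add: cell_cost_def cell_radius_def)
  also have "4 * \<delta> * norm x \<le> cell_error \<delta> R x"
    using s delta by (intro cell_error_ge) auto
  finally show "1/2 * (norm x)\<^sup>2 \<le> cell_cost \<delta> z 0 + cell_error \<delta> R x" by simp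
  moreover have "cell_cost \<delta> z 0 = cell_cost \<delta> 0 z"
    by (simp add: cell_cost_def algebra_simps)
  ultimately show "1/2 * (norm x)\<^sup>2 \<le> cell_cost \<delta> 0 z + cell_error \<delta> R x" by simp
qed

lemma w_at_0: "z \<in> I \<Longrightarrow> norm x \<le> \<delta> / 2 \<Longrightarrow> w z x = 0"
  using support_cell[of z x] nonneg(1)[of z x] delta by (cases "w z x = 0") (auto simp: less_le)

lemma w'_eq_0: "norm x \<le> R \<Longrightarrow> w' x = 0"
  using support'[of x] nonneg(2)[of x] by (cases "w' x = 0") (auto simp: less_le)

lemma w_le_1: "z \<in> insert 0 I \<Longrightarrow> w z x \<le> 1" and w'_le_1: "w' x \<le> 1"
proof -
  have "w z x \<le> (\<Sum>z\<in>insert 0 I. w z x)" if "z \<in> insert 0 I"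
    using that fin nonneg by (intro member_le_sum) auto
  then show "z \<in> insert 0 I \<Longrightarrow> w z x \<le> 1" using sum_eq_1[of x] nonneg(2)[of x] by fastforce
  have "0 \<le> (\<Sum>z\<in>insert 0 I. w z x)" using nonneg by (intro sum_nonneg) auto
  then show "w' x \<le> 1" using sum_eq_1[of x] by linarith
qed

lemma w_measurable [measurable]: "w z \<in> borel_measurable borel" "w' \<in> borel_measurable borel"
  by (intro borel_measurable_continuous_onI twice_cont_diff_continuous smooth)+

lemma w_le_square: "z \<in> I \<Longrightarrow> w z x \<le> (norm x)\<^sup>2 / (\<delta> / 2)\<^sup>2"
proof -
  assume z: "z \<in> I"
  show ?thesis
  proof (cases "norm x \<le> \<delta> / 2")
    case True
    then show ?thesis using w_at_0[OF z True] by simp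
  next
    case False
    then have "(\<delta>/2)\<^sup>2 \<le> (norm x)\<^sup>2" using delta by (intro power_mono) auto
    then have "1 \<le> (norm x)\<^sup>2 / (\<delta> / 2)\<^sup>2" using delta by simp
    then show ?thesis using w_le_1[of z x] z by simp
  qed
qed

lemma w'_le_square: "R\<^sup>2 / 2 * w' x \<le> cell_error \<delta> R x"
proof (cases "R < norm x")
  case True
  have "R\<^sup>2 / 2 * w' x \<le> R\<^sup>2 / 2 * 1" using w'_le_1[of x] by (intro mult_left_mono) auto
  also have "\<dots> \<le> (norm x)\<^sup>2 / 2" using True delta by (simp add: power_mono)
  also have "\<dots> \<le> cell_error \<delta> R x" using True delta by (intro cell_error_ge_large) auto
  finally show ?thesis .
next
  case False
  then show ?thesis using w'_eq_0[of x] cell_error_nonneg[of \<delta> R x] delta by simp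
qed

text \<open>The discrete potential \<open>u\<close> spread over the cells: a convex combination of the values \<open>u z\<close>,
  of the value 0 on the cell at the origin, and of \<open>- R\<^sup>2 / 2\<close> far away. Feasible potentials
  are at most \<open>R\<^sup>2 / 2\<close>, so the constraint holds automatically wherever one of them has the
  last value; yet \<open>R\<^sup>2\<close> times the mass outside the ball of radius \<open>R\<close> tends to 0.\<close>

definition potential :: "('a \<Rightarrow> real) \<Rightarrow> 'a \<Rightarrow> real" where
  "potential u x = (\<Sum>z\<in>I. u z * w z x) - R\<^sup>2 / 2 * w' x"

lemma potential_smooth: "twice_cont_diff (potential u)"
proof -
  have "twice_cont_diff (\<lambda>x. (\<Sum>z\<in>I. u z * w z x) + (- (R\<^sup>2 / 2)) * w' x)"
    by (intro twice_cont_diff_add twice_cont_diff_sum twice_cont_diff_cmult smooth)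
  then show ?thesis by (simp add: potential_def[abs_def])
qed

lemma potential_near_0: "norm x \<le> \<delta> / 2 \<Longrightarrow> potential u x = 0"
  using delta by (simp add: potential_def w_at_0 w'_eq_0)

lemma potential_bounded: "bounded (range (potential u))"
proof -
  have "norm (potential u x) \<le> (\<Sum>z\<in>I. \<bar>u z\<bar>) + R\<^sup>2 / 2" for x
  proof -
    have "\<bar>\<Sum>z\<in>I. u z * w z x\<bar> \<le> (\<Sum>z\<in>I. \<bar>u z\<bar> * 1)"
      by (rule order_trans[OF sum_abs]) (auto intro!: sum_mono mult_left_mono simp: abs_mult abs_of_nonneg[OF nonneg(1)] w_le_1 mult_left_le)
    moreover have "\<bar>R\<^sup>2 / 2 * w' x\<bar> \<le> R\<^sup>2 / 2 * 1"
      using w'_le_1[of x] nonneg(2)[of x] by (auto simp: abs_mult mult_left_le)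
    ultimately show ?thesis by (simp add: potential_def)
  qed
  then show ?thesis by (auto intro!: boundedI)
qed

lemma potential_in_class:
  "(\<lambda>x. ereal (potential u x)) \<in> class_C2_bounded_vanishing"
proof -
  have "\<forall>\<^sub>F x in nhds 0. potential u x = 0"
    unfolding eventually_nhds_metric using delta
    by (intro exI[of _ "\<delta>/2"]) (auto intro: potential_near_0)
  then show ?thesis
    using potential_smooth potential_bounded
    unfolding class_C2_bounded_vanishing_def C2_bounded_def vanishes_near_0_def by blast
qed

lemma potential_convex_combination:
  "potential u x = (\<Sum>z\<in>insert 0 I. w z x * (if z = 0 then 0 else u z)) + w' x * (- (R\<^sup>2 / 2))"
proof -
  have "(\<Sum>z\<in>insert 0 I. w z x * (if z = 0 then 0 else u z)) = (\<Sum>z\<in>I. u z * w z x)"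
    using fin centre_nz by (subst sum.insert) (auto intro!: sum.cong)
  then show ?thesis by (simp add: potential_def)
qed

text \<open>Both potentials are convex combinations, so their sum at \<open>(x, y)\<close> is a convex combination of
  sums \<open>u z + v z'\<close> over cells containing \<open>x\<close> and \<open>y\<close>, each bounded by the cell cost and
  therefore by the true cost. The constraint thus holds exactly and everywhere, for functions
  that are smooth and vanish near the origin.\<close>

lemma potential_admissible:
  assumes u0: "u 0 = 0" and v0: "v 0 = 0"
    and uv: "\<And>z z'. z \<in> insert 0 I \<Longrightarrow> z' \<in> insert 0 I \<Longrightarrow> u z + v z' \<le> cell_cost \<delta> z z'"
  shows "potential u x + potential v y \<le> 1/2 * (norm (x - y))\<^sup>2"
proof -
  let ?K = "insert 0 I"
  define c where "c = 1/2 * (norm (x - y))\<^sup>2"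
  define B where "B = R\<^sup>2 / 2"
  have c: "0 \<le> c" by (simp add: c_def)
  \<comment> \<open>The constraint against the reservoir bounds the discrete potentials by \<open>R\<^sup>2 / 2\<close>.\<close>
  have k0: "cell_cost \<delta> z z' \<le> B" if "z \<in> ?K" "z' \<in> ?K" "z = 0 \<or> z' = 0" for z z'
  proof -
    have "norm (z - z') \<le> R" using that centre delta by auto
    then have "max 0 (norm (z - z') - cell_radius \<delta> z - cell_radius \<delta> z') \<le> R"
      using delta by (auto simp: cell_radius_def)
    then have "(max 0 (norm (z - z') - cell_radius \<delta> z - cell_radius \<delta> z'))\<^sup>2 \<le> R\<^sup>2"
      by (intro power_mono) auto
    then show ?thesis by (simp add: cell_cost_def B_def)
  qed
  have u: "u z \<le> B" and v: "v z \<le> B" if "z \<in> ?K" for z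
    using uv[of z 0] uv[of 0 z] k0[of z 0] k0[of 0 z] that u0 v0 by auto
  have pu: "potential f x = (\<Sum>z\<in>?K. w z x * f z) + w' x * (- B)" if "f 0 = 0" for f x
    unfolding potential_convex_combination B_def using that by (intro arg_cong2[where f = "(+)"] sum.cong) auto
  have 1: "potential u x + v z' \<le> c" if z': "z' \<in> ?K" "0 < w z' y" for z'
  proof -
    have "potential u x + v z' = (\<Sum>z\<in>?K. w z x * u z) + w' x * (- B) + ((\<Sum>z\<in>?K. w z x) + w' x) * v z'"
      by (simp add: pu[of u, OF u0] sum_eq_1 del: sum.insert)
    also have "\<dots> = (\<Sum>z\<in>?K. w z x * (u z + v z')) + w' x * (v z' - B)"
      by (simp add: algebra_simps sum.distrib sum_distrib_left del: sum.insert)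
    also have "\<dots> \<le> (\<Sum>z\<in>?K. w z x * c) + w' x * c"
    proof (intro add_mono sum_mono)
      fix z assume z: "z \<in> ?K"
      show "w z x * (u z + v z') \<le> w z x * c"
      proof (cases "w z x = 0")
        case False
        then have "0 < w z x" using nonneg(1)[of z x] by (simp add: less_le)
        then have "cell_cost \<delta> z z' \<le> c"
          unfolding c_def using support z'(2) by (intro cell_cost_le) auto
        then show ?thesis using uv[OF z z'(1)] nonneg by (intro mult_left_mono) auto
      qed simp
    next
      show "w' x * (v z' - B) \<le> w' x * c"
        using v[OF z'(1)] c nonneg by (intro mult_left_mono) auto
    qed
    also have "\<dots> = c * ((\<Sum>z\<in>?K. w z x) + w' x)"
      by (simp add: algebra_simps sum_distrib_left del: sum.insert)
    finally show ?thesis by (simp add: sum_eq_1 del: sum.insert)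
  qed
  have 2: "potential u x - B \<le> 0"
  proof -
    have "potential u x \<le> (\<Sum>z\<in>?K. w z x * B) + w' x * B"
      unfolding pu[of u, OF u0] using u nonneg by (intro add_mono sum_mono mult_left_mono) (auto simp: B_def)
    also have "\<dots> = B * ((\<Sum>z\<in>?K. w z x) + w' x)"
      by (simp add: algebra_simps sum_distrib_left del: sum.insert)
    finally show ?thesis by (simp add: sum_eq_1 del: sum.insert)
  qed
  have "potential u x + potential v y
      = (\<Sum>z\<in>?K. w z y * v z) + w' y * (- B) + ((\<Sum>z\<in>?K. w z y) + w' y) * potential u x"
    by (simp add: pu[of v, OF v0] sum_eq_1 del: sum.insert)
  also have "\<dots> = (\<Sum>z\<in>?K. w z y * (potential u x + v z)) + w' y * (potential u x - B)"
    by (simp add: algebra_simps sum.distrib sum_distrib_left del: sum.insert)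
  also have "\<dots> \<le> (\<Sum>z\<in>?K. w z y * c) + w' y * c"
  proof (intro add_mono sum_mono)
    fix z assume z: "z \<in> ?K"
    show "w z y * (potential u x + v z) \<le> w z y * c"
    proof (cases "w z y = 0")
      case False
      then have "0 < w z y" using nonneg(1)[of z y] by (simp add: less_le)
      then show ?thesis using 1[OF z] by simp
    qed simp
  next
    show "w' y * (potential u x - B) \<le> w' y * c"
      using 2 c nonneg by (intro mult_left_mono) auto
  qed
  also have "\<dots> = c * ((\<Sum>z\<in>?K. w z y) + w' y)"
    by (simp add: algebra_simps sum_distrib_left del: sum.insert)
  finally show ?thesis by (simp add: sum_eq_1 c_def del: sum.insert)
qed

end

section \<open>Couplings given by densities\<close>

text \<open>The measure \<open>M\<close> plus a unit mass at 0. A Levy coupling may send any amount of mass to or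
  from the origin; with an atom there, such couplings become densities with respect to a
  product measure.\<close>

definition add_atom :: "'a::euclidean_space measure \<Rightarrow> 'a measure" where
  "add_atom M = measure_of UNIV (sets borel) (\<lambda>A. emeasure M A + indicator A 0)"

lemma sets_add_atom [measurable_cong]: "sets (add_atom M) = sets borel"
  and space_add_atom [simp]: "space (add_atom M) = UNIV"
  unfolding add_atom_def using sets.sigma_algebra_axioms[of "borel :: 'a::euclidean_space measure"]
  by (auto simp: sigma_algebra.sets_measure_of_eq sigma_algebra.sigma_sets_eq)

lemma emeasure_add_atom:
  assumes "sets M = sets borel" "A \<in> sets borel"
  shows "emeasure (add_atom M) A = emeasure M A + indicator A 0"
  unfolding add_atom_def
proof (rule emeasure_measure_of_sigma)
  show "sigma_algebra UNIV (sets borel :: 'a set set)"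
    using sets.sigma_algebra_axioms[of "borel :: 'a::euclidean_space measure"] by simp
  show "positive (sets borel) (\<lambda>A. emeasure M A + indicator A 0)" by (simp add: positive_def)
  show "countably_additive (sets borel) (\<lambda>A. emeasure M A + indicator A 0)"
  proof (rule countably_additiveI)
    fix A :: "nat \<Rightarrow> 'a set"
    assume A: "range A \<subseteq> sets borel" "disjoint_family A"
    then have "(\<Sum>i. emeasure M (A i)) = emeasure M (\<Union>i. A i)"
      by (intro suminf_emeasure) (auto simp: assms(1))
    moreover have "(\<Sum>i. indicator (A i) (0::'a) :: ennreal) = indicator (\<Union>i. A i) 0"
      by (rule suminf_indicator[OF A(2)])
    ultimately show "(\<Sum>i. emeasure M (A i) + indicator (A i) 0)
        = emeasure M (\<Union> (range A)) + indicator (\<Union> (range A)) 0"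
      by (subst suminf_add[symmetric]) auto
  qed
qed (use assms in auto)

text \<open>Away from 0 the measures \<open>add_atom M\<close> and \<open>M\<close> agree, and \<open>M\<close> does not charge 0; so
  restricting \<open>add_atom M\<close> to the complement of 0 gives back \<open>M\<close>.\<close>

lemma nn_integral_add_atom:
  assumes M: "sets M = sets borel" "emeasure M {0} = 0" and f: "f \<in> borel_measurable borel"
  shows "(\<integral>\<^sup>+ x. f x \<partial>add_atom M) = (\<integral>\<^sup>+ x. f x \<partial>M) + f 0"
proof -
  have f' [measurable]: "f \<in> borel_measurable (add_atom M)"
    using f by (simp cong: measurable_cong_sets add: sets_add_atom)
  have meas [measurable]: "indicator (- {0}) \<in> borel_measurable (add_atom M)"
      "indicator {0} \<in> borel_measurable (add_atom M)"
    by (auto simp: sets_add_atom intro!: borel_measurable_indicator)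
  have "density (add_atom M) (indicator (- {0})) = M"
  proof (rule measure_eqI)
    show "sets (density (add_atom M) (indicator (- {0}))) = sets M" using M by (simp add: sets_add_atom)
    fix A assume "A \<in> sets (density (add_atom M) (indicator (- {0})))"
    then have A: "A \<in> sets borel" by (simp add: sets_add_atom)
    have "emeasure (density (add_atom M) (indicator (- {0}))) A = (\<integral>\<^sup>+ x. indicator (- {0}) x * indicator A x \<partial>add_atom M)"
      using A by (subst emeasure_density) (auto simp: sets_add_atom)
    also have "\<dots> = (\<integral>\<^sup>+ x. indicator (A - {0}) x \<partial>add_atom M)"
      by (intro nn_integral_cong) (auto split: split_indicator)
    also have "\<dots> = emeasure (add_atom M) (A - {0})"
      using A by (intro nn_integral_indicator) (auto simp: sets_add_atom)
    also have "\<dots> = emeasure M (A - {0})" using A M by (subst emeasure_add_atom) auto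
    also have "\<dots> = emeasure M A" using M A by (intro emeasure_Diff_null_set) (auto simp: null_sets_def)
    finally show "emeasure (density (add_atom M) (indicator (- {0}))) A = emeasure M A" .
  qed
  then have "(\<integral>\<^sup>+ x. f x \<partial>M) = (\<integral>\<^sup>+ x. f x \<partial>density (add_atom M) (indicator (- {0})))" by simp
  also have "\<dots> = (\<integral>\<^sup>+ x. indicator (- {0}) x * f x \<partial>add_atom M)"
    by (rule nn_integral_density) measurable
  finally have 1: "(\<integral>\<^sup>+ x. f x \<partial>M) = (\<integral>\<^sup>+ x. indicator (- {0}) x * f x \<partial>add_atom M)" .
  have "(\<integral>\<^sup>+ x. f x \<partial>add_atom M) = (\<integral>\<^sup>+ x. indicator (- {0}) x * f x + f 0 * indicator {0} x \<partial>add_atom M)"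
    by (intro nn_integral_cong) (auto split: split_indicator)
  also have "\<dots> = (\<integral>\<^sup>+ x. indicator (- {0}) x * f x \<partial>add_atom M) + (\<integral>\<^sup>+ x. f 0 * indicator {0} x \<partial>add_atom M)"
    by (rule nn_integral_add) measurable
  also have "(\<integral>\<^sup>+ x. f 0 * indicator {0} x \<partial>add_atom M) = f 0"
    using M by (subst nn_integral_cmult_indicator) (auto simp: sets_add_atom emeasure_add_atom)
  finally show ?thesis by (simp add: 1)
qed

text \<open>Markov's inequality for \<open>min 1 |x|\<^sup>2\<close>.\<close>

lemma levy_measure_finite_away:
  assumes M: "levy_measure M" and e: "0 < e" and A: "A \<in> sets borel" "\<And>x. x \<in> A \<Longrightarrow> e \<le> norm x"
  shows "emeasure M A < \<infinity>"
proof -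
  define c where "c = min 1 (e\<^sup>2)"
  have c: "c > 0" using e by (simp add: c_def)
  have sets: "sets M = sets borel" using M by (simp add: levy_measure_def)
  have "ennreal c * emeasure M A = (\<integral>\<^sup>+ x. ennreal c * indicator A x \<partial>M)"
    using A sets by (simp add: nn_integral_cmult_indicator)
  also have "\<dots> \<le> (\<integral>\<^sup>+ x. ennreal (min 1 ((norm x)\<^sup>2)) \<partial>M)"
  proof (intro nn_integral_mono)
    fix x show "ennreal c * indicator A x \<le> ennreal (min 1 ((norm x)\<^sup>2))"
      using A(2)[of x] e by (auto simp: c_def split: split_indicator intro!: ennreal_leI min.coboundedI2 power_mono)
  qed
  also have "\<dots> < \<infinity>" using M by (simp add: levy_measure_def)
  finally show ?thesis using c by (auto simp: ennreal_mult_less_top ennreal_mult_eq_top_iff less_top)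
qed

lemma sigma_finite_add_atom:
  assumes "levy_measure M" shows "sigma_finite_measure (add_atom M)"
proof
  have sets: "sets M = sets borel" using assms by (simp add: levy_measure_def)
  define F where "F = (\<lambda>n::nat. insert 0 {x :: 'a. 1 / real (Suc n) \<le> norm x})"
  have F: "F n \<in> sets borel" for n unfolding F_def by measurable
  have *: "emeasure (add_atom M) (F n) \<noteq> \<infinity>" for n
  proof -
    have "emeasure M (F n) \<le> emeasure M {0} + emeasure M {x. 1 / real (Suc n) \<le> norm x}"
      unfolding F_def by (subst insert_is_Un, intro emeasure_subadditive) (auto simp: sets)
    moreover have "emeasure M {x. 1 / real (Suc n) \<le> norm x} < \<infinity>"
      by (rule levy_measure_finite_away[OF assms, of "1 / real (Suc n)"]) auto
    moreover have "emeasure M {0} = 0" using assms by (simp add: levy_measure_def)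
    ultimately have "emeasure M (F n) < \<infinity>" by (auto simp: less_top[symmetric] top_unique)
    then show ?thesis using F[of n]
      by (subst emeasure_add_atom[OF sets]) (auto simp: less_top split: split_indicator)
  qed
  have un: "(\<Union>n. F n) = UNIV"
  proof -
    have "\<exists>n. x \<in> F n" for x
    proof (cases "x = 0")
      case False
      then obtain n where "inverse (real (Suc n)) < norm x" using reals_Archimedean[of "norm x"] by auto
      then show ?thesis by (intro exI[of _ n]) (auto simp: F_def inverse_eq_divide)
    qed (auto simp: F_def)
    then show ?thesis by auto
  qed
  show "\<exists>A. countable A \<and> A \<subseteq> sets (add_atom M) \<and> \<Union> A = space (add_atom M) \<and>
      (\<forall>a\<in>A. emeasure (add_atom M) a \<noteq> \<infinity>)"
    using F * un by (intro exI[of _ "range F"]) (auto simp: sets_add_atom)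
qed

lemma Lambda2D:
  assumes "M \<in> Lambda2"
  shows "levy_measure M" "sets M = sets borel" "space M = UNIV" "emeasure M {0} = 0"
    "(\<integral>\<^sup>+ x. ennreal ((norm x)\<^sup>2) \<partial>M) < \<infinity>"
proof -
  show s: "sets M = sets borel" using assms by (simp add: Lambda2_def levy_measure_def)
  show "space M = UNIV" using sets_eq_imp_space_eq[OF s] by simp
qed (use assms in \<open>simp_all add: Lambda2_def levy_measure_def\<close>)

lemma sets_pair_add_atom [measurable_cong]:
  "sets (add_atom \<mu> \<Otimes>\<^sub>M add_atom \<nu>) = sets borel"
  unfolding borel_prod[symmetric] by (rule sets_pair_measure_cong) (auto simp: sets_add_atom)

text \<open>Normalization of \<open>h\<close> is required for nonzero \<open>x\<close> and \<open>y\<close> only: the marginals of a Levy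
  coupling are prescribed only away from the origin, where the atoms are not seen.\<close>

lemma levy_coupling_of_density:
  fixes \<mu> \<nu> :: "'a::euclidean_space measure" and h :: "'a \<times> 'a \<Rightarrow> ennreal"
  assumes mu: "\<mu> \<in> Lambda2" and nu: "\<nu> \<in> Lambda2"
    and h [measurable]: "h \<in> borel_measurable borel" and h0: "h (0, 0) = 0"
    and hx: "\<And>x. x \<noteq> 0 \<Longrightarrow> (\<integral>\<^sup>+ y. h (x, y) \<partial>add_atom \<nu>) = 1"
    and hy: "\<And>y. y \<noteq> 0 \<Longrightarrow> (\<integral>\<^sup>+ x. h (x, y) \<partial>add_atom \<mu>) = 1"
  defines "\<gamma> \<equiv> density (add_atom \<mu> \<Otimes>\<^sub>M add_atom \<nu>) h"
  shows "\<gamma> \<in> levy_couplings \<mu> \<nu>"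
    and "\<And>f. f \<in> borel_measurable borel \<Longrightarrow> f 0 = 0 \<Longrightarrow> (\<integral>\<^sup>+ z. f (fst z) \<partial>\<gamma>) = (\<integral>\<^sup>+ x. f x \<partial>\<mu>)"
    and "\<And>f. f \<in> borel_measurable borel \<Longrightarrow> f 0 = 0 \<Longrightarrow> (\<integral>\<^sup>+ z. f (snd z) \<partial>\<gamma>) = (\<integral>\<^sup>+ x. f x \<partial>\<nu>)"
proof -
  let ?M = "add_atom \<mu>" and ?N = "add_atom \<nu>"
  note m = Lambda2D[OF mu] and n = Lambda2D[OF nu]
  interpret M: sigma_finite_measure ?M by (rule sigma_finite_add_atom[OF m(1)])
  interpret N: sigma_finite_measure ?N by (rule sigma_finite_add_atom[OF n(1)])
  interpret P: pair_sigma_finite ?M ?N ..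
  have sg: "sets \<gamma> = sets borel" by (simp add: \<gamma>_def sets_pair_add_atom)
  have spg: "space \<gamma> = UNIV" using sets_eq_imp_space_eq[OF sg] by simp
  have hm: "h \<in> borel_measurable (?M \<Otimes>\<^sub>M ?N)" by measurable
  have I: "(\<integral>\<^sup>+ z. F z \<partial>\<gamma>) = (\<integral>\<^sup>+ x. \<integral>\<^sup>+ y. h (x, y) * F (x, y) \<partial>?N \<partial>?M)"
    if F [measurable]: "F \<in> borel_measurable borel" for F :: "'a \<times> 'a \<Rightarrow> ennreal"
  proof -
    have "(\<integral>\<^sup>+ z. F z \<partial>\<gamma>) = (\<integral>\<^sup>+ z. h z * F z \<partial>(?M \<Otimes>\<^sub>M ?N))"
      unfolding \<gamma>_def by (rule nn_integral_density) measurable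
    also have "\<dots> = (\<integral>\<^sup>+ x. \<integral>\<^sup>+ y. h (x, y) * F (x, y) \<partial>?N \<partial>?M)"
      by (subst N.nn_integral_fst[symmetric]) measurable
    finally show ?thesis .
  qed
  have I': "(\<integral>\<^sup>+ z. F z \<partial>\<gamma>) = (\<integral>\<^sup>+ y. \<integral>\<^sup>+ x. h (x, y) * F (x, y) \<partial>?M \<partial>?N)"
    if F [measurable]: "F \<in> borel_measurable borel" for F :: "'a \<times> 'a \<Rightarrow> ennreal"
  proof -
    have "(\<lambda>z. h z * F z) \<in> borel_measurable (?M \<Otimes>\<^sub>M ?N)" by measurable
    then have "(\<lambda>(x, y). h (x, y) * F (x, y)) \<in> borel_measurable (?M \<Otimes>\<^sub>M ?N)"
      by (simp add: case_prod_beta')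
    from P.Fubini'[OF this] show ?thesis unfolding I[OF F] by simp
  qed
  have fstm: "(\<lambda>z. f (fst z)) \<in> borel_measurable borel" and sndm: "(\<lambda>z. f (snd z)) \<in> borel_measurable borel"
    if "f \<in> borel_measurable borel" for f :: "'a \<Rightarrow> ennreal"
    by (rule measurable_compose[OF _ that]; rule borel_measurable_continuous_onI;
        intro continuous_intros)+
  have hsx: "(\<lambda>y. h (x, y)) \<in> borel_measurable ?N" for x
    by measurable
  have hsy: "(\<lambda>x. h (x, y)) \<in> borel_measurable ?M" for y
    by measurable
  show fstI: "(\<integral>\<^sup>+ z. f (fst z) \<partial>\<gamma>) = (\<integral>\<^sup>+ x. f x \<partial>\<mu>)"
    if f: "f \<in> borel_measurable borel" "f 0 = 0" for f :: "'a \<Rightarrow> ennreal"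
  proof -
    have "(\<integral>\<^sup>+ z. f (fst z) \<partial>\<gamma>) = (\<integral>\<^sup>+ x. \<integral>\<^sup>+ y. h (x, y) * f x \<partial>?N \<partial>?M)"
      using I[OF fstm[OF f(1)]] by simp
    also have "\<dots> = (\<integral>\<^sup>+ x. f x \<partial>?M)"
      using hx f(2) by (intro nn_integral_cong)
        (metis mult_1 mult_zero_right nn_integral_0_iff_AE nn_integral_multc[OF hsx] mult.commute)
    also have "\<dots> = (\<integral>\<^sup>+ x. f x \<partial>\<mu>)" by (subst nn_integral_add_atom[OF m(2,4) f(1)]) (simp add: f(2))
    finally show ?thesis .
  qed
  show sndI: "(\<integral>\<^sup>+ z. f (snd z) \<partial>\<gamma>) = (\<integral>\<^sup>+ x. f x \<partial>\<nu>)"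
    if f: "f \<in> borel_measurable borel" "f 0 = 0" for f :: "'a \<Rightarrow> ennreal"
  proof -
    have "(\<integral>\<^sup>+ z. f (snd z) \<partial>\<gamma>) = (\<integral>\<^sup>+ y. \<integral>\<^sup>+ x. h (x, y) * f y \<partial>?M \<partial>?N)"
      using I'[OF sndm[OF f(1)]] by simp
    also have "\<dots> = (\<integral>\<^sup>+ y. f y \<partial>?N)"
      using hy f(2) by (intro nn_integral_cong)
        (metis mult_1 mult_zero_right nn_integral_0_iff_AE nn_integral_multc[OF hsy] mult.commute)
    also have "\<dots> = (\<integral>\<^sup>+ x. f x \<partial>\<nu>)" by (subst nn_integral_add_atom[OF n(2,4) f(1)]) (simp add: f(2))
    finally show ?thesis .
  qed
  have "emeasure \<gamma> {0} = 0"
  proof -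
    have "emeasure \<gamma> {0} = (\<integral>\<^sup>+ z. h z * indicator {0} z \<partial>(?M \<Otimes>\<^sub>M ?N))"
      unfolding \<gamma>_def by (rule emeasure_density[OF hm]) (simp add: sets_pair_add_atom)
    also have "\<dots> = (\<integral>\<^sup>+ z. 0 \<partial>(?M \<Otimes>\<^sub>M ?N))"
      using h0 by (intro nn_integral_cong) (auto split: split_indicator simp: zero_prod_def)
    finally show ?thesis by simp
  qed
  moreover have "(\<integral>\<^sup>+ z. ennreal (min 1 ((norm z)\<^sup>2)) \<partial>\<gamma>) < \<infinity>"
  proof -
    have "(\<integral>\<^sup>+ z. ennreal (min 1 ((norm z)\<^sup>2)) \<partial>\<gamma>)
        \<le> (\<integral>\<^sup>+ z. ennreal ((norm (fst z))\<^sup>2) + ennreal ((norm (snd z))\<^sup>2) \<partial>\<gamma>)"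
    proof (intro nn_integral_mono)
      fix z :: "'a \<times> 'a"
      have "(norm z)\<^sup>2 = (norm (fst z))\<^sup>2 + (norm (snd z))\<^sup>2" by (simp add: norm_prod_def)
      then show "ennreal (min 1 ((norm z)\<^sup>2)) \<le> ennreal ((norm (fst z))\<^sup>2) + ennreal ((norm (snd z))\<^sup>2)"
        by (simp flip: ennreal_plus add: ennreal_leI)
    qed
    also have "\<dots> = (\<integral>\<^sup>+ z. ennreal ((norm (fst z))\<^sup>2) \<partial>\<gamma>) + (\<integral>\<^sup>+ z. ennreal ((norm (snd z))\<^sup>2) \<partial>\<gamma>)"
      using sg fstm[of "\<lambda>x. ennreal ((norm x)\<^sup>2)"] sndm[of "\<lambda>x. ennreal ((norm x)\<^sup>2)"]
      by (intro nn_integral_add) (auto cong: measurable_cong_sets)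
    also have "\<dots> < \<infinity>"
      using fstI[of "\<lambda>x. ennreal ((norm x)\<^sup>2)"] sndI[of "\<lambda>x. ennreal ((norm x)\<^sup>2)"] m(5) n(5)
      by simp
    finally show ?thesis .
  qed
  moreover have "emeasure \<gamma> (E \<times> UNIV) = emeasure \<mu> E \<and> emeasure \<gamma> (UNIV \<times> E) = emeasure \<nu> E"
    if E: "E \<in> sets borel" and U: "open U" "0 \<in> U" "E \<inter> U = {}" for E U
  proof -
    have [measurable]: "E \<in> sets borel" by fact
    have 0: "0 \<notin> E" using U by auto
    have s: "E \<times> (UNIV :: 'a set) \<in> sets \<gamma>" "(UNIV :: 'a set) \<times> E \<in> sets \<gamma>"
      using E unfolding sg borel_prod[symmetric] by auto
    have "emeasure \<gamma> (E \<times> UNIV) = (\<integral>\<^sup>+ z. indicator (E \<times> UNIV) z \<partial>\<gamma>)"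
      using s by simp
    also have "\<dots> = (\<integral>\<^sup>+ z. indicator E (fst z) \<partial>\<gamma>)"
      by (intro nn_integral_cong) (auto split: split_indicator)
    also have "\<dots> = emeasure \<mu> E"
      using 0 E m(2) by (subst fstI) auto
    finally have 1: "emeasure \<gamma> (E \<times> UNIV) = emeasure \<mu> E" .
    have "emeasure \<gamma> (UNIV \<times> E) = (\<integral>\<^sup>+ z. indicator (UNIV \<times> E) z \<partial>\<gamma>)"
      using s by simp
    also have "\<dots> = (\<integral>\<^sup>+ z. indicator E (snd z) \<partial>\<gamma>)"
      by (intro nn_integral_cong) (auto split: split_indicator)
    also have "\<dots> = emeasure \<nu> E"
      using 0 E n(2) by (subst sndI) auto
    finally show ?thesis using 1 by simp
  qed
  ultimately show "\<gamma> \<in> levy_couplings \<mu> \<nu>"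
    using sg unfolding levy_couplings_def levy_measure_def by blast
qed

section \<open>Weak duality\<close>

text \<open>A marginal prescribed on the sets bounded away from 0 determines the integrals of all
  functions vanishing at 0: \<open>A - {0}\<close> is the increasing union of the sets \<open>A \<inter> {|x| \<ge> 1 / n}\<close>.\<close>

lemma nn_integral_marginal:
  fixes p :: "'b::euclidean_space \<Rightarrow> 'a::euclidean_space"
  assumes g: "sets \<gamma> = sets borel" and M: "sets M = sets borel" "emeasure M {0} = 0"
    and p: "p \<in> borel_measurable borel"
    and marg: "\<And>E. E \<in> sets borel \<Longrightarrow> \<exists>U. open U \<and> 0 \<in> U \<and> E \<inter> U = {} \<Longrightarrow>
      emeasure \<gamma> (p -` E) = emeasure M E"
    and f: "f \<in> borel_measurable borel" "f 0 = (0 :: ennreal)"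
  shows "(\<integral>\<^sup>+ z. f (p z) \<partial>\<gamma>) = (\<integral>\<^sup>+ x. f x \<partial>M)"
proof -
  let ?P = "distr \<gamma> borel p"
  have spg: "space \<gamma> = UNIV" using sets_eq_imp_space_eq[OF g] by simp
  have p' [measurable]: "p \<in> \<gamma> \<rightarrow>\<^sub>M borel" using p by (simp cong: measurable_cong_sets add: g)
  have "density ?P (indicator (- {0})) = M"
  proof (rule measure_eqI)
    show "sets (density ?P (indicator (- {0}))) = sets M" using M by simp
    fix A assume "A \<in> sets (density ?P (indicator (- {0})))"
    then have A: "A \<in> sets borel" by simp
    define F where "F = (\<lambda>n::nat. A \<inter> {x. 1 / real (Suc n) \<le> norm x})"
    have F: "F n \<in> sets borel" for n unfolding F_def using A by measurable
    have incF: "incseq F"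
    proof (rule incseq_SucI)
      fix n show "F n \<subseteq> F (Suc n)" unfolding F_def
        using divide_left_mono[of "real (Suc n)" "real (Suc (Suc n))" 1] by auto
    qed
    have un: "(\<Union>n. F n) = A - {0}"
    proof -
      have "\<exists>n. 1 / real (Suc n) \<le> norm x" if x: "x \<noteq> 0" for x :: 'a
      proof -
        obtain n where "inverse (real (Suc n)) < norm x" using reals_Archimedean[of "norm x"] x by auto
        then show ?thesis by (intro exI[of _ n]) (auto simp: inverse_eq_divide)
      qed
      then show ?thesis by (auto simp: F_def)
    qed
    have eF: "emeasure \<gamma> (p -` F n) = emeasure M (F n)" for n
    proof (rule marg[OF F])
      show "\<exists>U. open U \<and> 0 \<in> U \<and> F n \<inter> U = {}"
        by (intro exI[of _ "ball 0 (1 / real (Suc n))"]) (auto simp: F_def)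
    qed
    have "emeasure (density ?P (indicator (- {0}))) A = (\<integral>\<^sup>+ x. indicator (- {0}) x * indicator A x \<partial>?P)"
      using A by (subst emeasure_density) auto
    also have "\<dots> = (\<integral>\<^sup>+ x. indicator (A - {0}) x \<partial>?P)"
      by (intro nn_integral_cong) (auto split: split_indicator)
    also have "\<dots> = emeasure ?P (A - {0})"
      using A by (intro nn_integral_indicator) auto
    also have "\<dots> = (SUP n. emeasure ?P (F n))"
      unfolding un[symmetric] using F incF by (intro SUP_emeasure_incseq[symmetric]) auto
    also have "\<dots> = (SUP n. emeasure M (F n))"
      using eF F by (simp add: emeasure_distr spg)
    also have "\<dots> = emeasure M (A - {0})"
      unfolding un[symmetric] using F incF M by (intro SUP_emeasure_incseq) auto
    also have "\<dots> = emeasure M A" using M A by (intro emeasure_Diff_null_set) (auto simp: null_sets_def)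
    finally show "emeasure (density ?P (indicator (- {0}))) A = emeasure M A" .
  qed
  then have "(\<integral>\<^sup>+ x. f x \<partial>M) = (\<integral>\<^sup>+ x. f x \<partial>density ?P (indicator (- {0})))" by simp
  also have "\<dots> = (\<integral>\<^sup>+ x. indicator (- {0}) x * f x \<partial>?P)"
    using f by (intro nn_integral_density) auto
  also have "\<dots> = (\<integral>\<^sup>+ x. f x \<partial>?P)"
    using f(2) by (intro nn_integral_cong) (auto split: split_indicator)
  also have "\<dots> = (\<integral>\<^sup>+ z. f (p z) \<partial>\<gamma>)"
    using f(1) by (intro nn_integral_distr) auto
  finally show ?thesis by simp
qed

lemma levy_coupling_marginals:
  assumes "\<gamma> \<in> levy_couplings \<mu> \<nu>" and "\<mu> \<in> Lambda2" "\<nu> \<in> Lambda2"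
    and "f \<in> borel_measurable borel" "f 0 = (0 :: ennreal)"
  shows "(\<integral>\<^sup>+ z. f (fst z) \<partial>\<gamma>) = (\<integral>\<^sup>+ x. f x \<partial>\<mu>)"
    and "(\<integral>\<^sup>+ z. f (snd z) \<partial>\<gamma>) = (\<integral>\<^sup>+ x. f x \<partial>\<nu>)"
proof -
  have g: "sets \<gamma> = sets borel" using assms(1) by (simp add: levy_couplings_def levy_measure_def)
  have v: "fst -` E = E \<times> (UNIV :: 'a set)" "snd -` E = (UNIV :: 'a set) \<times> E" for E :: "'a set" by auto
  show "(\<integral>\<^sup>+ z. f (fst z) \<partial>\<gamma>) = (\<integral>\<^sup>+ x. f x \<partial>\<mu>)"
    using assms(1) by (intro nn_integral_marginal[OF g] Lambda2D[OF assms(2)] assms(4,5))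
      (auto simp: v levy_couplings_def intro!: borel_measurable_continuous_onI continuous_intros)
  show "(\<integral>\<^sup>+ z. f (snd z) \<partial>\<gamma>) = (\<integral>\<^sup>+ x. f x \<partial>\<nu>)"
    using assms(1) by (intro nn_integral_marginal[OF g] Lambda2D[OF assms(3)] assms(4,5))
      (auto simp: v levy_couplings_def intro!: borel_measurable_continuous_onI continuous_intros)
qed

lemma lsc_borel_measurable: "lsc f \<Longrightarrow> f \<in> borel_measurable borel"
  unfolding lsc_def by (intro borel_measurableI_greater) auto

text \<open>The constraint with all negative parts moved to the right, so that it becomes an inequality
  between nonnegative functions, which can be integrated even where the negative parts are
  infinite.\<close>

lemma pos_neg_parts_le:
  assumes "x + y \<le> ereal c" "x < \<infinity>" "y < \<infinity>" "0 \<le> c"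
  shows "e2ennreal x + e2ennreal y \<le> ennreal c + (e2ennreal (- x) + e2ennreal (- y))"
proof (cases "x = -\<infinity> \<or> y = -\<infinity>")
  case True
  then show ?thesis by auto
next
  case False
  then obtain a b where ab: "x = ereal a" "y = ereal b" using assms(2,3) by (cases x; cases y) auto
  have e: "e2ennreal (ereal t) = ennreal (max 0 t)" for t
    by (cases "0 \<le> t") (auto simp: max_def ennreal_neg)
  have "max 0 a + max 0 b \<le> c + (max 0 (- a) + max 0 (- b))"
    using assms(1,4) ab by (auto simp: max_def)
  then show ?thesis unfolding ab uminus_ereal.simps e using assms(4)
    by (simp flip: ennreal_plus add: ennreal_leI)
qed

text \<open>Integrate the constraint against the coupling; \<open>\<phi> 0 = \<psi> 0 = 0\<close> allows the marginals to be
  used. The positive parts are integrable because \<open>\<phi> x = \<phi> x + \<psi> 0 \<le> |x|\<^sup>2 / 2\<close>; if a negative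
  part has infinite integral, the left-hand side is \<open>-\<infinity>\<close>.\<close>

lemma weak_duality:
  fixes \<mu> \<nu> :: "'a::euclidean_space measure"
  assumes mu: "\<mu> \<in> Lambda2" and nu: "\<nu> \<in> Lambda2" and g: "\<gamma> \<in> levy_couplings \<mu> \<nu>"
    and ad: "(\<phi>, \<psi>) \<in> admissible_pairs class_lsc"
  shows "ereal_integral \<mu> \<phi> + ereal_integral \<nu> \<psi>
    \<le> enn2ereal (\<integral>\<^sup>+ (x, y). ennreal (1/2 * (norm (x - y))\<^sup>2) \<partial>\<gamma>)"
proof -
  have sg [measurable_cong]: "sets \<gamma> = sets borel" using g by (simp add: levy_couplings_def levy_measure_def)
  have lsc: "lsc \<phi>" "lsc \<psi>" and fin: "\<And>x. \<phi> x < \<infinity>" "\<And>x. \<psi> x < \<infinity>" and z: "\<phi> 0 = 0" "\<psi> 0 = 0"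
    and le: "\<And>x y. \<phi> x + \<psi> y \<le> ereal (1/2 * (norm (x - y))\<^sup>2)"
    using ad by (auto simp: admissible_pairs_def class_lsc_def)
  have [measurable]: "\<phi> \<in> borel_measurable borel" "\<psi> \<in> borel_measurable borel"
    by (auto intro: lsc_borel_measurable lsc)
  have [measurable]: "(fst :: 'a \<times> 'a \<Rightarrow> 'a) \<in> borel_measurable borel" "(snd :: 'a \<times> 'a \<Rightarrow> 'a) \<in> borel_measurable borel"
    by (auto intro!: borel_measurable_continuous_onI continuous_intros)
  let ?C = "\<integral>\<^sup>+ (x, y). ennreal (1/2 * (norm (x - y))\<^sup>2) \<partial>\<gamma>"
  let ?P = "\<integral>\<^sup>+ x. e2ennreal (\<phi> x) \<partial>\<mu>" and ?P' = "\<integral>\<^sup>+ x. e2ennreal (- \<phi> x) \<partial>\<mu>"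
  let ?Q = "\<integral>\<^sup>+ x. e2ennreal (\<psi> x) \<partial>\<nu>" and ?Q' = "\<integral>\<^sup>+ x. e2ennreal (- \<psi> x) \<partial>\<nu>"
  have fin': "(\<integral>\<^sup>+ x. e2ennreal (\<theta> x) \<partial>M) < \<infinity>"
    if "\<And>x. \<theta> x \<le> ereal (1/2 * (norm x)\<^sup>2)" "M \<in> Lambda2" for \<theta> and M :: "'a measure"
  proof -
    have "e2ennreal (\<theta> x) \<le> ennreal ((norm x)\<^sup>2)" for x
    proof -
      have "\<theta> x \<le> ereal ((norm x)\<^sup>2)" by (rule order_trans[OF that(1)]) simp
      then have "e2ennreal (\<theta> x) \<le> e2ennreal (ereal ((norm x)\<^sup>2))" by (rule e2ennreal_mono)
      then show ?thesis by simp
    qed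
    then have "(\<integral>\<^sup>+ x. e2ennreal (\<theta> x) \<partial>M) \<le> (\<integral>\<^sup>+ x. ennreal ((norm x)\<^sup>2) \<partial>M)"
      by (rule nn_integral_mono)
    also have "\<dots> < \<infinity>" by (rule Lambda2D(5)[OF that(2)])
    finally show ?thesis .
  qed
  have P: "?P < \<infinity>" using le[of _ 0] z by (intro fin'[OF _ mu]) simp
  have Q: "?Q < \<infinity>" using le[of 0] z by (intro fin'[OF _ nu]) simp
  have "?P + ?Q = (\<integral>\<^sup>+ z. e2ennreal (\<phi> (fst z)) \<partial>\<gamma>) + (\<integral>\<^sup>+ z. e2ennreal (\<psi> (snd z)) \<partial>\<gamma>)"
    using levy_coupling_marginals[OF g mu nu, of "\<lambda>x. e2ennreal (\<phi> x)"]
      levy_coupling_marginals[OF g mu nu, of "\<lambda>x. e2ennreal (\<psi> x)"] z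
    by (simp add: e2ennreal_neg)
  also have "\<dots> = (\<integral>\<^sup>+ z. e2ennreal (\<phi> (fst z)) + e2ennreal (\<psi> (snd z)) \<partial>\<gamma>)"
    by (rule nn_integral_add[symmetric]) measurable
  also have "\<dots> \<le> (\<integral>\<^sup>+ z. ennreal (1/2 * (norm (fst z - snd z))\<^sup>2)
        + (e2ennreal (- \<phi> (fst z)) + e2ennreal (- \<psi> (snd z))) \<partial>\<gamma>)"
    by (intro nn_integral_mono pos_neg_parts_le le fin) simp
  also have "\<dots> = (\<integral>\<^sup>+ z. ennreal (1/2 * (norm (fst z - snd z))\<^sup>2) \<partial>\<gamma>)
        + ((\<integral>\<^sup>+ z. e2ennreal (- \<phi> (fst z)) \<partial>\<gamma>) + (\<integral>\<^sup>+ z. e2ennreal (- \<psi> (snd z)) \<partial>\<gamma>))"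
    by (subst nn_integral_add; (subst nn_integral_add)?) measurable
  also have "\<dots> = ?C + (?P' + ?Q')"
    using levy_coupling_marginals[OF g mu nu, of "\<lambda>x. e2ennreal (- \<phi> x)"]
      levy_coupling_marginals[OF g mu nu, of "\<lambda>x. e2ennreal (- \<psi> x)"] z
    by (simp add: case_prod_beta' e2ennreal_neg)
  finally have main: "?P + ?Q \<le> ?C + (?P' + ?Q')" .
  have arith: "(enn2ereal p - enn2ereal p') + (enn2ereal q - enn2ereal q') \<le> enn2ereal c"
    if "p < \<infinity>" "q < \<infinity>" "p + q \<le> c + (p' + q')" for p p' q q' c :: ennreal
    using that
    by (cases p rule: ennreal_cases; cases q rule: ennreal_cases; cases p' rule: ennreal_cases;
        cases q' rule: ennreal_cases; cases c rule: ennreal_cases)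
      (auto simp: enn2ereal_ennreal simp flip: ennreal_plus)
  show ?thesis unfolding ereal_integral_def by (rule arith[OF P Q main])
qed

section \<open>Integrals over cells and discrete potentials\<close>

lemma Lambda2_integrable_norm_square:
  assumes M: "M \<in> Lambda2" shows "integrable M (\<lambda>x. (norm x)\<^sup>2)"
proof (rule integrableI_bounded)
  show "(\<lambda>x. (norm x)\<^sup>2) \<in> borel_measurable M"
    by (subst measurable_cong_sets[OF Lambda2D(2)[OF M] refl]) measurable
qed (use Lambda2D(5)[OF M] in simp)

lemma Lambda2_integrable:
  assumes M: "M \<in> Lambda2" and f: "f \<in> borel_measurable borel" "\<And>x. \<bar>f x\<bar> \<le> C * (norm x)\<^sup>2"
  shows "integrable M (f :: 'a::euclidean_space \<Rightarrow> real)"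
proof (rule Bochner_Integration.integrable_bound)
  show "integrable M (\<lambda>x. C * (norm x)\<^sup>2)"
    using Lambda2_integrable_norm_square[OF M] by simp
  show "f \<in> borel_measurable M"
    using f(1) by (subst measurable_cong_sets[OF Lambda2D(2)[OF M] refl])
  show "AE x in M. norm (f x) \<le> norm (C * (norm x)\<^sup>2)"
    using order_trans[OF f(2) abs_ge_self] by (intro AE_I2) simp
qed

lemma ereal_integral_real:
  assumes "integrable M f"
  shows "ereal_integral M (\<lambda>x. ereal (f x)) = ereal (\<integral>x. f x \<partial>M)"
proof -
  have "(\<integral>\<^sup>+ x. ennreal (f x) \<partial>M) < \<infinity>" "(\<integral>\<^sup>+ x. ennreal (- f x) \<partial>M) < \<infinity>"
    using assms by (auto simp: real_integrable_def less_top)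
  then have "enn2ereal (\<integral>\<^sup>+ x. ennreal (f x) \<partial>M) = ereal (enn2real (\<integral>\<^sup>+ x. ennreal (f x) \<partial>M))"
    "enn2ereal (\<integral>\<^sup>+ x. ennreal (- f x) \<partial>M) = ereal (enn2real (\<integral>\<^sup>+ x. ennreal (- f x) \<partial>M))"
    by (metis ennreal_enn2real enn2ereal_ennreal enn2real_nonneg infinity_ennreal_def)+
  then show ?thesis
    by (simp add: ereal_integral_def real_lebesgue_integral_def[OF assms])
qed

context smooth_cells
begin

lemma integrable_w:
  assumes "M \<in> Lambda2" "z \<in> I" shows "integrable M (w z)"
  using w_le_square[OF assms(2)] nonneg
  by (intro Lambda2_integrable[OF assms(1), of _ "1 / (\<delta> / 2)\<^sup>2"]) auto

lemma integrable_cell_error: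
  fixes M :: "'a measure"
  assumes "M \<in> Lambda2" shows "integrable M (cell_error \<delta> R)"
proof (rule Lambda2_integrable[OF assms, of _ 9])
  show "\<bar>cell_error \<delta> R x\<bar> \<le> 9 * (norm x)\<^sup>2" for x :: 'a
    using cell_error_bound[of \<delta> R x] cell_error_nonneg[of \<delta> R x] delta by simp
qed simp

lemma integrable_w':
  assumes "M \<in> Lambda2" shows "integrable M w'"
proof (rule Lambda2_integrable[OF assms, of _ "18 / R\<^sup>2"])
  show "\<bar>w' x\<bar> \<le> 18 / R\<^sup>2 * (norm x)\<^sup>2" for x
    using order_trans[OF w'_le_square cell_error_bound, of x] nonneg(2)[of x] delta
    by (simp add: field_simps)
qed simp

lemma integrable_potential:
  assumes "M \<in> Lambda2" shows "integrable M (potential u)"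
  unfolding potential_def using assms
  by (intro Bochner_Integration.integrable_diff Bochner_Integration.integrable_sum
      integrable_mult_right integrable_w integrable_w')

lemma integral_potential_ge:
  assumes M: "M \<in> Lambda2"
  shows "(\<Sum>z\<in>I. (\<integral>x. w z x \<partial>M) * u z) - (\<integral>x. cell_error \<delta> R x \<partial>M) \<le> (\<integral>x. potential u x \<partial>M)"
proof -
  note i = integrable_w[OF M] integrable_w'[OF M] integrable_cell_error[OF M]
  have "(\<integral>x. potential u x \<partial>M) = (\<Sum>z\<in>I. u z * (\<integral>x. w z x \<partial>M)) - (\<integral>x. R\<^sup>2 / 2 * w' x \<partial>M)"
    unfolding potential_def using i
    by (subst Bochner_Integration.integral_diff) (auto simp: Bochner_Integration.integral_sum)
  moreover have "(\<integral>x. R\<^sup>2 / 2 * w' x \<partial>M) \<le> (\<integral>x. cell_error \<delta> R x \<partial>M)"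
    using i w'_le_square by (intro integral_mono) auto
  ultimately show ?thesis by (simp add: mult.commute)
qed

text \<open>Spreading discrete potentials over the cells turns them into competitors of the dual
  problem, with masses \<open>\<integral> w z\<close> as discrete marginals. Only the part with the value \<open>- R\<^sup>2 / 2\<close>
  far away is lost.\<close>

lemma cell_potentials_le_dual_value:
  assumes mu: "\<mu> \<in> Lambda2" and nu: "\<nu> \<in> Lambda2"
    and D: "dual_value class_C2_bounded_vanishing \<mu> \<nu> \<le> ereal D"
    and u0: "u 0 = 0" and v0: "v 0 = 0"
    and uv: "\<And>z z'. z \<in> insert 0 I \<Longrightarrow> z' \<in> insert 0 I \<Longrightarrow> u z + v z' \<le> cell_cost \<delta> z z'"
  shows "(\<Sum>z\<in>I. (\<integral>x. w z x \<partial>\<mu>) * u z) + (\<Sum>z\<in>I. (\<integral>x. w z x \<partial>\<nu>) * v z)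
    \<le> D + (\<integral>x. cell_error \<delta> R x \<partial>\<mu>) + (\<integral>x. cell_error \<delta> R x \<partial>\<nu>)"
proof -
  let ?p = "(\<lambda>x. ereal (potential u x), \<lambda>x. ereal (potential v x))"
  have "?p \<in> admissible_pairs class_C2_bounded_vanishing"
    using potential_in_class potential_admissible[OF u0 v0 uv] potential_near_0[of 0] delta
    by (auto simp: admissible_pairs_def)
  then have "ereal_integral \<mu> (\<lambda>x. ereal (potential u x)) + ereal_integral \<nu> (\<lambda>x. ereal (potential v x))
      \<le> dual_value class_C2_bounded_vanishing \<mu> \<nu>"
    unfolding dual_value_def by (rule SUP_upper2) simp
  from order_trans[OF this D] have "(\<integral>x. potential u x \<partial>\<mu>) + (\<integral>x. potential v x \<partial>\<nu>) \<le> D"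
    by (simp add: ereal_integral_real integrable_potential mu nu)
  then show ?thesis
    using integral_potential_ge[OF mu, of u] integral_potential_ge[OF nu, of v] by linarith
qed

text \<open>In the construction of the coupling, mass that a discrete plan sends to the reservoir is
  sent to the point 0 itself; so the weight of the cell at the origin is replaced by the
  indicator of 0.\<close>

definition cell_or_atom :: "'a \<Rightarrow> 'a \<Rightarrow> real" where
  "cell_or_atom z x = (if z = 0 then indicator {0} x else w z x)"

text \<open>The mass near the origin or far away, which the discrete plan does not see.\<close>

definition remainder :: "'a \<Rightarrow> real" where
  "remainder x = (if x = 0 then 0 else w 0 x + w' x)"

lemma cell_or_atom_nonneg: "0 \<le> cell_or_atom z x"
  and remainder_nonneg: "0 \<le> remainder x"
  using nonneg by (auto simp: cell_or_atom_def remainder_def)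

lemma cell_or_atom_measurable [measurable]: "cell_or_atom z \<in> borel_measurable borel"
  unfolding cell_or_atom_def[abs_def] by (cases "z = 0") auto

lemma remainder_measurable [measurable]: "remainder \<in> borel_measurable borel"
proof -
  have "remainder = (\<lambda>x. indicator (- {0}) x * (w 0 x + w' x))"
    by (auto simp: remainder_def fun_eq_iff)
  then show ?thesis by simp
qed

lemma sum_cell_or_atom: "x \<noteq> 0 \<Longrightarrow> (\<Sum>z\<in>insert 0 I. cell_or_atom z x) + remainder x = 1"
proof -
  assume x: "x \<noteq> 0"
  have "(\<Sum>z\<in>insert 0 I. cell_or_atom z x) = (\<Sum>z\<in>I. w z x)"
    using x fin centre_nz by (subst sum.insert) (auto simp: cell_or_atom_def intro!: sum.cong)
  moreover have "(\<Sum>z\<in>insert 0 I. w z x) = w 0 x + (\<Sum>z\<in>I. w z x)"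
    using fin centre_nz by simp
  ultimately show ?thesis using sum_eq_1[of x] x by (simp add: remainder_def)
qed

definition mass :: "'a measure \<Rightarrow> 'a \<Rightarrow> real" where
  "mass M z = (if z = 0 then 1 else \<integral>x. w z x \<partial>M)"

lemma mass_nonneg: "0 \<le> mass M z"
  using nonneg by (simp add: mass_def)

lemma nn_integral_cell_or_atom:
  assumes M: "M \<in> Lambda2" and z: "z \<in> insert 0 I"
  shows "(\<integral>\<^sup>+ x. ennreal (cell_or_atom z x) \<partial>add_atom M) = ennreal (mass M z)"
proof -
  note m = Lambda2D[OF M]
  have "(\<integral>\<^sup>+ x. ennreal (cell_or_atom z x) \<partial>add_atom M)
      = (\<integral>\<^sup>+ x. ennreal (cell_or_atom z x) \<partial>M) + ennreal (cell_or_atom z 0)"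
    by (rule nn_integral_add_atom[OF m(2,4)]) measurable
  also have "\<dots> = ennreal (mass M z)"
  proof (cases "z = 0")
    case True
    have "(\<integral>\<^sup>+ x. ennreal (cell_or_atom z x) \<partial>M) = (\<integral>\<^sup>+ x. indicator {0} x \<partial>M)"
      using True by (intro nn_integral_cong) (auto simp: cell_or_atom_def split: split_indicator)
    also have "\<dots> = 0" using m by simp
    finally show ?thesis using True by (simp add: cell_or_atom_def mass_def)
  next
    case False
    then show ?thesis using z w_at_0[of z 0] delta integrable_w[OF M] nonneg
      by (simp add: cell_or_atom_def mass_def nn_integral_eq_integral)
  qed
  finally show ?thesis .
qed

end

section \<open>Couplings realizing discrete plans\<close>

context smooth_cells
begin

text \<open>The density of the plan \<open>p\<close> with respect to the product of its marginals \<open>a\<close> and \<open>b\<close>. The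
  cells without mass need an arbitrary normalized value, and sending them to the origin is the
  simplest.\<close>

definition plan_weight :: "('a \<Rightarrow> real) \<Rightarrow> ('a \<Rightarrow> real) \<Rightarrow> ('a \<Rightarrow> 'a \<Rightarrow> real) \<Rightarrow> 'a \<Rightarrow> 'a \<Rightarrow> real" where
  "plan_weight a b p z z' =
    (if z = 0 \<and> z' = 0 then 0 else if z' = 0 \<and> a z = 0 \<or> z = 0 \<and> b z' = 0 then 1
     else p z z' / (a z * b z'))"

lemma plan_weight_transpose: "plan_weight b a (\<lambda>z z'. p z' z) z z' = plan_weight a b p z' z"
  by (auto simp: plan_weight_def mult.commute)

lemma plan_weight_sum:
  assumes a0: "a 0 = 1" "b 0 = 1" and p: "\<And>z z'. z \<in> insert 0 I \<Longrightarrow> z' \<in> insert 0 I \<Longrightarrow> 0 \<le> p z z'"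
    and row: "\<And>z. z \<in> I \<Longrightarrow> (\<Sum>z'\<in>insert 0 I. p z z') = a z"
    and col: "\<And>z'. z' \<in> I \<Longrightarrow> (\<Sum>z\<in>insert 0 I. p z z') = b z'"
    and z: "z \<in> I"
  shows "(\<Sum>z'\<in>insert 0 I. plan_weight a b p z z' * b z') = 1"
proof -
  have z0: "z \<noteq> 0" using centre_nz z by blast
  show ?thesis
  proof (cases "a z = 0")
    case True
    have "(\<Sum>z'\<in>insert 0 I. plan_weight a b p z z' * b z') = (\<Sum>z'\<in>insert 0 I. if z' = 0 then 1 else 0)"
      using True z0 a0 by (intro sum.cong) (auto simp: plan_weight_def)
    also have "\<dots> = 1" using fin by (subst sum.delta) auto
    finally show ?thesis .
  next
    case False
    have "plan_weight a b p z z' * b z' = p z z' / a z" if z': "z' \<in> insert 0 I" for z'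
    proof (cases "b z' = 0")
      case True
      then have "z' \<in> I" using z' a0 by auto
      then have "(\<Sum>z\<in>insert 0 I. p z z') = 0" using col True by simp
      then have "p z z' = 0"
        using sum_nonneg_eq_0_iff[of "insert 0 I" "\<lambda>z. p z z'"] p z' z fin by blast
      then show ?thesis using True by simp
    next
      case F: False
      then show ?thesis using False z0 by (simp add: plan_weight_def)
    qed
    then have "(\<Sum>z'\<in>insert 0 I. plan_weight a b p z z' * b z') = (\<Sum>z'\<in>insert 0 I. p z z') / a z"
      unfolding sum_divide_distrib by (intro sum.cong) auto
    then show ?thesis using row[OF z] False by simp
  qed
qed

lemma plan_weight_mass_le:
  assumes "0 \<le> p z z'"
  shows "plan_weight a b p z z' * a z * b z' \<le> p z z'"
  using assms by (auto simp: plan_weight_def)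

lemma plan_weight_nonneg:
  assumes "0 \<le> a z" "0 \<le> b z'" "0 \<le> p z z'" shows "0 \<le> plan_weight a b p z z'"
  using assms by (auto simp: plan_weight_def)

text \<open>The cells are coupled according to the weights \<open>q\<close>, the points of one pair of cells
  independently of each other; the remaining mass is moved to, or fetched from, the origin.\<close>

definition plan_density :: "('a \<Rightarrow> 'a \<Rightarrow> real) \<Rightarrow> 'a \<times> 'a \<Rightarrow> real" where
  "plan_density q = (\<lambda>(x, y). (\<Sum>z\<in>insert 0 I. \<Sum>z'\<in>insert 0 I. q z z' * cell_or_atom z x * cell_or_atom z' y)
     + remainder x * indicator {0} y + indicator {0} x * remainder y)"

lemma plan_density_measurable [measurable]: "plan_density q \<in> borel_measurable borel"
  unfolding plan_density_def borel_prod[symmetric] by measurable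

lemma plan_density_swap: "plan_density q (x, y) = plan_density (\<lambda>z z'. q z' z) (y, x)"
  unfolding plan_density_def by (subst sum.swap) (simp add: algebra_simps del: sum.insert)

lemma cell_or_atom_at_0: "z \<in> insert 0 I \<Longrightarrow> cell_or_atom z 0 = (if z = 0 then 1 else 0)"
  using w_at_0[of z 0] delta by (auto simp: cell_or_atom_def)

lemma plan_density_at_0:
  assumes "q 0 0 = 0" shows "plan_density q (0, 0) = 0"
proof -
  have "(\<Sum>z\<in>insert 0 I. \<Sum>z'\<in>insert 0 I. q z z' * cell_or_atom z 0 * cell_or_atom z' 0) = 0"
    using assms by (intro sum.neutral ballI) (auto simp: cell_or_atom_at_0)
  then show ?thesis by (simp add: plan_density_def remainder_def)
qed

lemma plan_density_nonneg:
  assumes "\<And>z z'. z \<in> insert 0 I \<Longrightarrow> z' \<in> insert 0 I \<Longrightarrow> 0 \<le> q z z'"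
  shows "0 \<le> plan_density q (x, y)"
  unfolding plan_density_def using assms
  by (auto intro!: add_nonneg_nonneg sum_nonneg mult_nonneg_nonneg cell_or_atom_nonneg remainder_nonneg
      simp del: sum.insert)

lemma nn_integral_plan_density:
  assumes nu: "\<nu> \<in> Lambda2" and x: "x \<noteq> 0"
    and q: "\<And>z z'. z \<in> insert 0 I \<Longrightarrow> z' \<in> insert 0 I \<Longrightarrow> 0 \<le> q z z'"
    and sum: "\<And>z. z \<in> I \<Longrightarrow> (\<Sum>z'\<in>insert 0 I. q z z' * mass \<nu> z') = 1"
  shows "(\<integral>\<^sup>+ y. ennreal (plan_density q (x, y)) \<partial>add_atom \<nu>) = 1"
proof -
  let ?K = "insert 0 I"
  define t where "t = (\<lambda>z'. (\<Sum>z\<in>?K. q z z' * cell_or_atom z x) + (if z' = 0 then remainder x else 0))"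
  have t: "0 \<le> t z'" if "z' \<in> ?K" for z'
    unfolding t_def using q that
    by (auto intro!: add_nonneg_nonneg sum_nonneg mult_nonneg_nonneg cell_or_atom_nonneg remainder_nonneg
        simp del: sum.insert)
  have dens: "plan_density q (x, y) = (\<Sum>z'\<in>?K. t z' * cell_or_atom z' y)" for y
  proof -
    have "(\<Sum>z'\<in>?K. t z' * cell_or_atom z' y)
      = (\<Sum>z'\<in>?K. \<Sum>z\<in>?K. q z z' * cell_or_atom z x * cell_or_atom z' y)
        + (\<Sum>z'\<in>?K. if z' = 0 then remainder x * cell_or_atom z' y else 0)"
      by (simp add: t_def ring_distribs sum.distrib sum_distrib_right if_distrib[of "\<lambda>c. c * _"]
          cong: if_cong del: sum.insert)
    also have "(\<Sum>z'\<in>?K. if z' = 0 then remainder x * cell_or_atom z' y else 0) = remainder x * indicator {0} y"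
      using fin by (subst sum.delta) (auto simp: cell_or_atom_def)
    finally show ?thesis using x
      by (subst (asm) sum.swap) (simp add: plan_density_def del: sum.insert)
  qed
  have "(\<integral>\<^sup>+ y. ennreal (plan_density q (x, y)) \<partial>add_atom \<nu>)
      = (\<integral>\<^sup>+ y. (\<Sum>z'\<in>?K. ennreal (t z') * ennreal (cell_or_atom z' y)) \<partial>add_atom \<nu>)"
  proof (rule nn_integral_cong)
    fix y
    have "ennreal (plan_density q (x, y)) = (\<Sum>z'\<in>?K. ennreal (t z' * cell_or_atom z' y))"
      unfolding dens using t cell_or_atom_nonneg by (intro sum_ennreal[symmetric]) auto
    also have "\<dots> = (\<Sum>z'\<in>?K. ennreal (t z') * ennreal (cell_or_atom z' y))"
      using t cell_or_atom_nonneg by (intro sum.cong refl ennreal_mult) auto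
    finally show "ennreal (plan_density q (x, y)) = (\<Sum>z'\<in>?K. ennreal (t z') * ennreal (cell_or_atom z' y))" .
  qed
  also have "\<dots> = (\<Sum>z'\<in>?K. \<integral>\<^sup>+ y. ennreal (t z') * ennreal (cell_or_atom z' y) \<partial>add_atom \<nu>)"
    by (rule nn_integral_sum) measurable
  also have "\<dots> = (\<Sum>z'\<in>?K. ennreal (t z' * mass \<nu> z'))"
    using t mass_nonneg by (intro sum.cong refl)
      (simp add: nn_integral_cmult nn_integral_cell_or_atom[OF nu] ennreal_mult)
  also have "\<dots> = ennreal (\<Sum>z'\<in>?K. t z' * mass \<nu> z')"
    using t mass_nonneg by (intro sum_ennreal) auto
  also have "(\<Sum>z'\<in>?K. t z' * mass \<nu> z') = 1"
  proof -
    have "(\<Sum>z'\<in>?K. t z' * mass \<nu> z')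
      = (\<Sum>z'\<in>?K. \<Sum>z\<in>?K. q z z' * cell_or_atom z x * mass \<nu> z')
        + (\<Sum>z'\<in>?K. if z' = 0 then remainder x * mass \<nu> z' else 0)"
      by (simp add: t_def ring_distribs sum.distrib sum_distrib_right if_distrib[of "\<lambda>c. c * _"]
          cong: if_cong del: sum.insert)
    also have "(\<Sum>z'\<in>?K. if z' = 0 then remainder x * mass \<nu> z' else 0) = remainder x"
      using fin by (subst sum.delta) (auto simp: mass_def)
    also have "(\<Sum>z'\<in>?K. \<Sum>z\<in>?K. q z z' * cell_or_atom z x * mass \<nu> z')
        = (\<Sum>z\<in>?K. cell_or_atom z x * (\<Sum>z'\<in>?K. q z z' * mass \<nu> z'))"
      by (subst sum.swap) (simp add: sum_distrib_left mult_ac del: sum.insert)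
    also have "\<dots> = (\<Sum>z\<in>?K. cell_or_atom z x)"
      using sum x by (intro sum.cong) (auto simp: cell_or_atom_def simp del: sum.insert)
    finally show ?thesis using sum_cell_or_atom[OF x] by simp
  qed
  finally show ?thesis by simp
qed

lemma cost_le_cell_or_atom:
  assumes z: "z \<in> insert 0 I" "z' \<in> insert 0 I" "z \<noteq> 0 \<or> z' \<noteq> 0"
    and p: "0 < cell_or_atom z x" "0 < cell_or_atom z' y"
  shows "1/2 * (norm (x - y))\<^sup>2 \<le> cell_cost \<delta> z z' + (cell_error \<delta> R x + cell_error \<delta> R y)"
proof -
  have R0: "0 \<le> R" using delta by simp
  consider "z \<in> I" "z' \<in> I" | "z \<in> I" "z' = 0" | "z = 0" "z' \<in> I" using z by auto
  then show ?thesis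
  proof cases
    case 1
    then show ?thesis using p centre_nz by (intro cost_le_cell_cost) (auto simp: cell_or_atom_def split: if_splits)
  next
    case 2
    then have "y = 0" "0 < w z x" using p centre_nz by (auto simp: cell_or_atom_def indicator_def split: if_splits)
    then show ?thesis using cost_le_cell_cost_0(1)[of z x] 2 R0 by simp
  next
    case 3
    then have "x = 0" "0 < w z' y" using p centre_nz by (auto simp: cell_or_atom_def indicator_def split: if_splits)
    then show ?thesis using cost_le_cell_cost_0(2)[of z' y] 3 R0 by simp
  qed
qed

lemma cost_le_remainder:
  "remainder x * (1/2 * (norm x)\<^sup>2) \<le> remainder x * cell_error \<delta> R x"
proof (cases "remainder x = 0")
  case False
  then have "0 < w 0 x \<or> 0 < w' x"
    using nonneg(1)[of 0 x] nonneg(2)[of x] by (auto simp: remainder_def less_le split: if_splits)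
  then have "norm x < 2 * \<delta> \<or> R < norm x"
    using support[of 0 x] support'[of x] by (auto simp: cell_radius_def)
  then have "1/2 * (norm x)\<^sup>2 \<le> cell_error \<delta> R x"
    using cell_error_ge_small[of x \<delta> R] cell_error_ge_large[of R x \<delta>] delta by auto
  then show ?thesis using remainder_nonneg by (intro mult_left_mono) auto
qed simp

text \<open>The cost splits into the cell cost and an error that is a sum of a function of \<open>x\<close> and a
  function of \<open>y\<close>. The integral of the error against the coupling then depends only on the
  marginals.\<close>

lemma plan_density_cost_le:
  assumes q: "\<And>z z'. z \<in> insert 0 I \<Longrightarrow> z' \<in> insert 0 I \<Longrightarrow> 0 \<le> q z z'" and q0: "q 0 0 = 0"
  shows "plan_density q (x, y) * (1/2 * (norm (x - y))\<^sup>2)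
    \<le> plan_density q (x, y) * (cell_error \<delta> R x + cell_error \<delta> R y)
      + (\<Sum>z\<in>insert 0 I. \<Sum>z'\<in>insert 0 I. q z z' * cell_cost \<delta> z z' * (cell_or_atom z x * cell_or_atom z' y))"
proof -
  let ?K = "insert 0 I"
  have R0: "0 \<le> R" using delta by simp
  define c where "c = 1/2 * (norm (x - y))\<^sup>2"
  define e where "e = cell_error \<delta> R x + cell_error \<delta> R y"
  have 1: "q z z' * cell_or_atom z x * cell_or_atom z' y * c
      \<le> q z z' * cell_or_atom z x * cell_or_atom z' y * e
        + q z z' * cell_cost \<delta> z z' * (cell_or_atom z x * cell_or_atom z' y)"
    if z: "z \<in> ?K" "z' \<in> ?K" for z z'
  proof (cases "q z z' * cell_or_atom z x * cell_or_atom z' y = 0")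
    case False
    have pos: "0 < cell_or_atom z x" "0 < cell_or_atom z' y" "z \<noteq> 0 \<or> z' \<noteq> 0"
      using False q0 cell_or_atom_nonneg[of z x] cell_or_atom_nonneg[of z' y] by (auto simp: less_le)
    have "c \<le> cell_cost \<delta> z z' + e"
      unfolding c_def e_def using cost_le_cell_or_atom[OF z pos(3,1,2)] .
    then have "q z z' * cell_or_atom z x * cell_or_atom z' y * c
        \<le> q z z' * cell_or_atom z x * cell_or_atom z' y * (cell_cost \<delta> z z' + e)"
      using q[OF z] pos by (intro mult_left_mono) auto
    then show ?thesis by (simp add: algebra_simps)
  qed auto
  have 2: "remainder x * indicator {0} y * c \<le> remainder x * indicator {0} y * e"
    using cost_le_remainder[of x] R0 by (auto simp: c_def e_def split: split_indicator)
  have 3: "indicator {0} x * remainder y * c \<le> indicator {0} x * remainder y * e"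
    using cost_le_remainder[of y] R0 by (auto simp: c_def e_def split: split_indicator)
  have "(\<Sum>z\<in>?K. \<Sum>z'\<in>?K. q z z' * cell_or_atom z x * cell_or_atom z' y) * c
    \<le> (\<Sum>z\<in>?K. \<Sum>z'\<in>?K. q z z' * cell_or_atom z x * cell_or_atom z' y) * e
       + (\<Sum>z\<in>?K. \<Sum>z'\<in>?K. q z z' * cell_cost \<delta> z z' * (cell_or_atom z x * cell_or_atom z' y))"
    unfolding sum_distrib_right sum.distrib[symmetric] by (intro sum_mono 1)
  with 2 3 show ?thesis
    unfolding plan_density_def c_def[symmetric] e_def[symmetric] prod.case ring_distribs by linarith
qed

text \<open>A plan for the cells is realized by a genuine coupling of \<open>\<mu>\<close> and \<open>\<nu>\<close>, at the cost of the
  plan up to the error, so a cheap plan bounds the infimum directly.\<close>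

lemma levy_cost_le_cell_plan:
  assumes mu: "\<mu> \<in> Lambda2" and nu: "\<nu> \<in> Lambda2"
    and p: "\<And>z z'. z \<in> insert 0 I \<Longrightarrow> z' \<in> insert 0 I \<Longrightarrow> 0 \<le> p z z'"
    and row: "\<And>z. z \<in> I \<Longrightarrow> (\<Sum>z'\<in>insert 0 I. p z z') = (\<integral>x. w z x \<partial>\<mu>)"
    and col: "\<And>z'. z' \<in> I \<Longrightarrow> (\<Sum>z\<in>insert 0 I. p z z') = (\<integral>x. w z' x \<partial>\<nu>)"
  shows "levy_cost \<mu> \<nu> \<le> ennreal ((\<Sum>z\<in>insert 0 I. \<Sum>z'\<in>insert 0 I. p z z' * cell_cost \<delta> z z')
    + (\<integral>x. cell_error \<delta> R x \<partial>\<mu>) + (\<integral>x. cell_error \<delta> R x \<partial>\<nu>))"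
proof -
  let ?K = "insert 0 I" and ?M = "add_atom \<mu>" and ?N = "add_atom \<nu>"
  note m = Lambda2D[OF mu] and n = Lambda2D[OF nu]
  interpret N: sigma_finite_measure ?N by (rule sigma_finite_add_atom[OF n(1)])
  define q where "q = plan_weight (mass \<mu>) (mass \<nu>) p"
  define h where "h = (\<lambda>z. ennreal (plan_density q z))"
  have row': "(\<Sum>z'\<in>?K. p z z') = mass \<mu> z" and col': "(\<Sum>z'\<in>?K. p z' z) = mass \<nu> z" if "z \<in> I" for z
    using row[OF that] col[OF that] centre_nz(1)[OF that] by (simp_all add: mass_def del: sum.insert)
  have m0: "mass \<mu> 0 = 1" "mass \<nu> 0 = 1" by (simp_all add: mass_def)
  have q: "0 \<le> q z z'" if "z \<in> ?K" "z' \<in> ?K" for z z'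
    unfolding q_def using p[OF that] mass_nonneg by (intro plan_weight_nonneg) auto
  have q0: "q 0 0 = 0" by (simp add: q_def plan_weight_def)
  have hm [measurable]: "h \<in> borel_measurable borel" unfolding h_def by measurable
  have h0: "h (0, 0) = 0" by (simp add: h_def plan_density_at_0[of q, OF q0])
  have hx: "(\<integral>\<^sup>+ y. h (x, y) \<partial>?N) = 1" if "x \<noteq> 0" for x
    unfolding h_def
  proof (rule nn_integral_plan_density[OF nu that q])
    show "(\<Sum>z'\<in>?K. q z z' * mass \<nu> z') = 1" if z: "z \<in> I" for z
      unfolding q_def by (rule plan_weight_sum[OF m0 p row' col' z])
  qed
  have hy: "(\<integral>\<^sup>+ x. h (x, y) \<partial>?M) = 1" if y: "y \<noteq> 0" for y
  proof -
    have "(\<integral>\<^sup>+ x. h (x, y) \<partial>?M) = (\<integral>\<^sup>+ x. ennreal (plan_density (\<lambda>z z'. q z' z) (y, x)) \<partial>?M)"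
      unfolding h_def by (subst plan_density_swap) simp
    also have "\<dots> = 1"
    proof (rule nn_integral_plan_density[OF mu y])
      fix z assume z: "z \<in> I"
      have "(\<Sum>z'\<in>?K. plan_weight (mass \<nu>) (mass \<mu>) (\<lambda>z z'. p z' z) z z' * mass \<mu> z') = 1"
        by (rule plan_weight_sum[where a = "mass \<nu>" and b = "mass \<mu>" and p = "\<lambda>z z'. p z' z",
              OF m0(2,1) p col' row' z])
      then show "(\<Sum>z'\<in>?K. q z' z * mass \<mu> z') = 1" 
        unfolding q_def plan_weight_transpose[of "mass \<nu>" "mass \<mu>" p] .
    qed (use q in auto)
    finally show ?thesis .
  qed
  define \<gamma> where "\<gamma> = density (?M \<Otimes>\<^sub>M ?N) h"
  define E where "E = (\<lambda>x :: 'a. ennreal (cell_error \<delta> R x))"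
  have Em [measurable]: "E \<in> borel_measurable borel" unfolding E_def by measurable
  have E0: "E 0 = 0" using delta by (simp add: E_def)
  have gam: "\<gamma> \<in> levy_couplings \<mu> \<nu>" "(\<integral>\<^sup>+ z. E (fst z) \<partial>\<gamma>) = (\<integral>\<^sup>+ x. E x \<partial>\<mu>)"
      "(\<integral>\<^sup>+ z. E (snd z) \<partial>\<gamma>) = (\<integral>\<^sup>+ x. E x \<partial>\<nu>)"
    unfolding \<gamma>_def
    by (rule levy_coupling_of_density[OF mu nu hm h0 hx hy]; (assumption | rule Em E0))+
  have fs [measurable]: "(fst :: 'a \<times> 'a \<Rightarrow> 'a) \<in> borel_measurable borel" "(snd :: 'a \<times> 'a \<Rightarrow> 'a) \<in> borel_measurable borel"
    by (auto intro!: borel_measurable_continuous_onI continuous_intros)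
  define T where "T = (\<lambda>(x, y). \<Sum>z\<in>?K. \<Sum>z'\<in>?K. ennreal (q z z' * cell_cost \<delta> z z') *
    (ennreal (cell_or_atom z x) * ennreal (cell_or_atom z' y)))"
  have qk: "0 \<le> q z z' * cell_cost \<delta> z z'" if "z \<in> ?K" "z' \<in> ?K" for z z'
    using q[OF that] by (simp add: cell_cost_nonneg)
  have Te: "T (x, y) = ennreal (\<Sum>z\<in>?K. \<Sum>z'\<in>?K. q z z' * cell_cost \<delta> z z' * (cell_or_atom z x * cell_or_atom z' y))" for x y
  proof -
    have "ennreal (q z z' * cell_cost \<delta> z z') * (ennreal (cell_or_atom z x) * ennreal (cell_or_atom z' y))
        = ennreal (q z z' * cell_cost \<delta> z z' * (cell_or_atom z x * cell_or_atom z' y))"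
      if "z \<in> ?K" "z' \<in> ?K" for z z'
      using qk[OF that] cell_or_atom_nonneg by (simp add: ennreal_mult)
    then have "T (x, y) = (\<Sum>z\<in>?K. \<Sum>z'\<in>?K. ennreal (q z z' * cell_cost \<delta> z z' * (cell_or_atom z x * cell_or_atom z' y)))"
      unfolding T_def prod.case by (intro sum.cong refl)
    also have "\<dots> = (\<Sum>z\<in>?K. ennreal (\<Sum>z'\<in>?K. q z z' * cell_cost \<delta> z z' * (cell_or_atom z x * cell_or_atom z' y)))"
      using qk cell_or_atom_nonneg by (intro sum.cong refl sum_ennreal) auto
    also have "\<dots> = ennreal (\<Sum>z\<in>?K. \<Sum>z'\<in>?K. q z z' * cell_cost \<delta> z z' * (cell_or_atom z x * cell_or_atom z' y))"
      using qk cell_or_atom_nonneg by (intro sum_ennreal sum_nonneg) auto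
    finally show ?thesis .
  qed
  have Tm: "T \<in> borel_measurable borel"
    unfolding T_def borel_prod[symmetric] by measurable
  then have [measurable]: "T \<in> borel_measurable (?M \<Otimes>\<^sub>M ?N)" by measurable
  have hm' [measurable]: "h \<in> borel_measurable (?M \<Otimes>\<^sub>M ?N)" by measurable
  have cm: "(\<lambda>(x, y). ennreal (1/2 * (norm (x - y :: 'a))\<^sup>2)) \<in> borel_measurable borel"
    unfolding borel_prod[symmetric] by measurable
  have "(\<integral>\<^sup>+ z. T z \<partial>(?M \<Otimes>\<^sub>M ?N)) = ennreal (\<Sum>z\<in>?K. \<Sum>z'\<in>?K. q z z' * cell_cost \<delta> z z' * (mass \<mu> z * mass \<nu> z'))"
  proof -
    have "(\<integral>\<^sup>+ z. T z \<partial>(?M \<Otimes>\<^sub>M ?N)) = (\<integral>\<^sup>+ x. \<integral>\<^sup>+ y. T (x, y) \<partial>?N \<partial>?M)"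
      by (rule N.nn_integral_fst[symmetric]) measurable
    also have "\<dots> = (\<Sum>z\<in>?K. \<Sum>z'\<in>?K. ennreal (q z z' * cell_cost \<delta> z z') * (ennreal (mass \<mu> z) * ennreal (mass \<nu> z')))"
      unfolding T_def prod.case
      by (simp add: nn_integral_sum nn_integral_cmult nn_integral_multc nn_integral_cell_or_atom[OF nu]
          nn_integral_cell_or_atom[OF mu] del: sum.insert)
    also have "\<dots> = (\<Sum>z\<in>?K. \<Sum>z'\<in>?K. ennreal (q z z' * cell_cost \<delta> z z' * (mass \<mu> z * mass \<nu> z')))"
      using qk mass_nonneg by (intro sum.cong refl) (simp add: ennreal_mult)
    also have "\<dots> = (\<Sum>z\<in>?K. ennreal (\<Sum>z'\<in>?K. q z z' * cell_cost \<delta> z z' * (mass \<mu> z * mass \<nu> z')))"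
      using qk mass_nonneg by (intro sum.cong refl sum_ennreal) auto
    also have "\<dots> = ennreal (\<Sum>z\<in>?K. \<Sum>z'\<in>?K. q z z' * cell_cost \<delta> z z' * (mass \<mu> z * mass \<nu> z'))"
      using qk mass_nonneg by (intro sum_ennreal sum_nonneg) auto
    finally show ?thesis .
  qed
  also have "\<dots> \<le> ennreal (\<Sum>z\<in>?K. \<Sum>z'\<in>?K. p z z' * cell_cost \<delta> z z')"
  proof (intro ennreal_leI sum_mono)
    fix z z' assume "z \<in> ?K" "z' \<in> ?K"
    then have "q z z' * mass \<mu> z * mass \<nu> z' \<le> p z z'"
      unfolding q_def by (intro plan_weight_mass_le p)
    from mult_right_mono[OF this cell_cost_nonneg[of \<delta> z z']]
    show "q z z' * cell_cost \<delta> z z' * (mass \<mu> z * mass \<nu> z') \<le> p z z' * cell_cost \<delta> z z'"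
      by (simp add: mult_ac)
  qed
  finally have Tle: "(\<integral>\<^sup>+ z. T z \<partial>(?M \<Otimes>\<^sub>M ?N)) \<le> ennreal (\<Sum>z\<in>?K. \<Sum>z'\<in>?K. p z z' * cell_cost \<delta> z z')" .
  have "levy_cost \<mu> \<nu> \<le> (\<integral>\<^sup>+ (x, y). ennreal (1/2 * (norm (x - y))\<^sup>2) \<partial>\<gamma>)"
    unfolding levy_cost_def using gam(1) by (rule INF_lower)
  also have "\<dots> = (\<integral>\<^sup>+ z. h z * (case z of (x, y) \<Rightarrow> ennreal (1/2 * (norm (x - y))\<^sup>2)) \<partial>(?M \<Otimes>\<^sub>M ?N))"
    unfolding \<gamma>_def using cm by (intro nn_integral_density hm') measurable
  also have "\<dots> \<le> (\<integral>\<^sup>+ z. h z * (E (fst z) + E (snd z)) + T z \<partial>(?M \<Otimes>\<^sub>M ?N))"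
  proof (rule nn_integral_mono)
    fix z :: "'a \<times> 'a"
    obtain x y where z: "z = (x, y)" by (cases z)
    have h: "0 \<le> plan_density q (x, y)" by (rule plan_density_nonneg[OF q])
    have e: "0 \<le> cell_error \<delta> R v" for v :: 'a using delta by (intro cell_error_nonneg) simp
    have "h z * ennreal (1/2 * (norm (x - y))\<^sup>2) = ennreal (plan_density q (x, y) * (1/2 * (norm (x - y))\<^sup>2))"
      unfolding h_def z by (subst ennreal_mult) (use h in auto)
    also have "\<dots> \<le> ennreal (plan_density q (x, y) * (cell_error \<delta> R x + cell_error \<delta> R y)
      + (\<Sum>z\<in>?K. \<Sum>z'\<in>?K. q z z' * cell_cost \<delta> z z' * (cell_or_atom z x * cell_or_atom z' y)))"
      by (intro ennreal_leI plan_density_cost_le q q0)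
    also have "\<dots> = h z * (E x + E y) + T z"
      unfolding h_def E_def z Te using h e q cell_cost_nonneg[of \<delta>] cell_or_atom_nonneg
      by (subst ennreal_plus)
        (auto simp: ennreal_mult ennreal_plus[symmetric] intro!: sum_nonneg mult_nonneg_nonneg add_nonneg_nonneg
          simp del: sum.insert ennreal_plus)
    finally show "h z * (case z of (x, y) \<Rightarrow> ennreal (1/2 * (norm (x - y))\<^sup>2)) \<le> h z * (E (fst z) + E (snd z)) + T z"
      by (simp add: z)
  qed
  also have "\<dots> = (\<integral>\<^sup>+ z. h z * (E (fst z) + E (snd z)) \<partial>(?M \<Otimes>\<^sub>M ?N)) + (\<integral>\<^sup>+ z. T z \<partial>(?M \<Otimes>\<^sub>M ?N))"
    by (rule nn_integral_add) measurable
  also have "(\<integral>\<^sup>+ z. h z * (E (fst z) + E (snd z)) \<partial>(?M \<Otimes>\<^sub>M ?N)) = (\<integral>\<^sup>+ z. E (fst z) + E (snd z) \<partial>\<gamma>)"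
    unfolding \<gamma>_def by (rule nn_integral_density[symmetric]) measurable
  also have "\<dots> = (\<integral>\<^sup>+ z. E (fst z) \<partial>\<gamma>) + (\<integral>\<^sup>+ z. E (snd z) \<partial>\<gamma>)"
    unfolding \<gamma>_def by (rule nn_integral_add) measurable
  also have "\<dots> = (\<integral>\<^sup>+ x. E x \<partial>\<mu>) + (\<integral>\<^sup>+ x. E x \<partial>\<nu>)"
    unfolding gam(2,3) ..
  also have "\<dots> = ennreal (\<integral>x. cell_error \<delta> R x \<partial>\<mu>) + ennreal (\<integral>x. cell_error \<delta> R x \<partial>\<nu>)"
    unfolding E_def using delta
    by (intro arg_cong2[where f = "(+)"] nn_integral_eq_integral integrable_cell_error mu nu AE_I2 cell_error_nonneg) auto
  also have "ennreal (\<integral>x. cell_error \<delta> R x \<partial>\<mu>) + ennreal (\<integral>x. cell_error \<delta> R x \<partial>\<nu>)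
      + (\<integral>\<^sup>+ z. T z \<partial>(?M \<Otimes>\<^sub>M ?N))
    \<le> ennreal (\<integral>x. cell_error \<delta> R x \<partial>\<mu>) + ennreal (\<integral>x. cell_error \<delta> R x \<partial>\<nu>)
      + ennreal (\<Sum>z\<in>?K. \<Sum>z'\<in>?K. p z z' * cell_cost \<delta> z z')"
    by (rule add_left_mono[OF Tle])
  also have "\<dots> = ennreal ((\<Sum>z\<in>?K. \<Sum>z'\<in>?K. p z z' * cell_cost \<delta> z z')
    + (\<integral>x. cell_error \<delta> R x \<partial>\<mu>) + (\<integral>x. cell_error \<delta> R x \<partial>\<nu>))"
  proof -
    have "0 \<le> (\<Sum>z\<in>?K. \<Sum>z'\<in>?K. p z z' * cell_cost \<delta> z z')"
      by (intro sum_nonneg mult_nonneg_nonneg p cell_cost_nonneg)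
    moreover have "0 \<le> (\<integral>x. cell_error \<delta> R x \<partial>M)" for M :: "'a measure"
      using delta by (intro Bochner_Integration.integral_nonneg cell_error_nonneg) simp
    ultimately show ?thesis by (simp add: ennreal_plus[symmetric] add_ac del: ennreal_plus sum.insert)
  qed
  finally show ?thesis .
qed

end

section \<open>Duality\<close>

lemma cell_error_integral_tendsto_0:
  fixes M :: "'a::euclidean_space measure"
  assumes M: "M \<in> Lambda2"
  shows "(\<lambda>n. \<integral>x. cell_error (1 / real (n + 2)) (real (n + 2)) x \<partial>M) \<longlonglongrightarrow> 0"
proof -
  let ?E = "\<lambda>n. cell_error (1 / real (n + 2)) (real (n + 2)) :: 'a \<Rightarrow> real"
  have "(\<lambda>n. \<integral>x. ?E n x \<partial>M) \<longlonglongrightarrow> (\<integral>x. 0 \<partial>M)"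
  proof (rule integral_dominated_convergence[where w = "\<lambda>x. 9 * (norm x)\<^sup>2"])
    show "integrable M (\<lambda>x. 9 * (norm x)\<^sup>2)" using Lambda2_integrable_norm_square[OF M] by simp
    show "?E n \<in> borel_measurable M" for n
      by (subst measurable_cong_sets[OF Lambda2D(2)[OF M] refl]) measurable
    show "AE x in M. norm (?E n x) \<le> 9 * (norm x)\<^sup>2" for n
    proof (rule AE_I2)
      fix x :: 'a
      show "norm (?E n x) \<le> 9 * (norm x)\<^sup>2"
        using cell_error_bound[of "1 / real (n + 2)" "real (n + 2)" x]
          cell_error_nonneg[of "1 / real (n + 2)" "real (n + 2)" x] by simp
    qed
    show "AE x in M. (\<lambda>n. ?E n x) \<longlonglongrightarrow> 0"
    proof (rule AE_I2)
      fix x :: 'a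
      have lim: "(\<lambda>n. 4 * norm x * (1 / real (n + 2))) \<longlonglongrightarrow> 0"
        using tendsto_mult[OF tendsto_const LIMSEQ_ignore_initial_segment[OF lim_1_over_n], of "4 * norm x" 2] by simp
      have "\<forall>\<^sub>F n in sequentially. norm x \<le> real (n + 2)"
        by (rule eventually_sequentiallyI[of "nat \<lceil>norm x\<rceil>"]) linarith
      then have "\<forall>\<^sub>F n in sequentially. norm (?E n x) \<le> 4 * norm x * (1 / real (n + 2))"
      proof eventually_elim
        case (elim n)
        then have "?E n x = min (4 * (1 / real (n + 2)) * norm x) (8 * (norm x)\<^sup>2)" by (simp add: cell_error_def)
        then show ?case using cell_error_nonneg[of "1 / real (n + 2)" "real (n + 2)" x] by (simp add: mult_ac)
      qed
      then show "(\<lambda>n. ?E n x) \<longlonglongrightarrow> 0" by (rule Lim_null_comparison[OF _ lim])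
    qed
  qed simp
  then show ?thesis by simp
qed

text \<open>For fixed \<open>\<delta>\<close> and \<open>R\<close>, an upper bound \<open>D\<close> of the dual problem bounds all discrete
  potentials, hence the cost of some discrete plan, hence the cost of some coupling. Each of
  the two passages between the discrete and the continuous problem costs one error term, and
  these tend to 0.\<close>

lemma levy_cost_le_dual_value:
  fixes \<mu> \<nu> :: "'a::euclidean_space measure"
  assumes mu: "\<mu> \<in> Lambda2" and nu: "\<nu> \<in> Lambda2"
  shows "enn2ereal (levy_cost \<mu> \<nu>) \<le> dual_value class_C2_bounded_vanishing \<mu> \<nu>"
proof (rule ereal_le_real)
  fix D assume D: "dual_value class_C2_bounded_vanishing \<mu> \<nu> \<le> ereal D"
  let ?e = "\<lambda>n. (\<integral>x. cell_error (1 / real (n + 2)) (real (n + 2)) x \<partial>\<mu>)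
      + (\<integral>x. cell_error (1 / real (n + 2)) (real (n + 2)) x \<partial>\<nu>)"
  have bound: "levy_cost \<mu> \<nu> \<le> ennreal (D + 2 * ?e n)" for n
  proof -
    have "1 / real (n + 2) < real (n + 2)" by (simp add: field_simps) (smt (verit) mult_nonneg_nonneg of_nat_0_le_iff)
    then obtain I :: "'a set" and w w' where c: "smooth_cells (1 / real (n + 2)) (real (n + 2)) I w w'"
      using smooth_cells_exist[of "1 / real (n + 2)" "real (n + 2)"] by auto
    interpret smooth_cells "1 / real (n + 2)" "real (n + 2)" I w w' by (rule c)
    obtain p where p: "\<And>i j. i \<in> insert 0 I \<Longrightarrow> j \<in> insert 0 I \<Longrightarrow> 0 \<le> p i j"
      "\<And>i. i \<in> I \<Longrightarrow> (\<Sum>j\<in>insert 0 I. p i j) = (\<integral>x. w i x \<partial>\<mu>)"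
      "\<And>j. j \<in> I \<Longrightarrow> (\<Sum>i\<in>insert 0 I. p i j) = (\<integral>x. w j x \<partial>\<nu>)"
      "(\<Sum>i\<in>insert 0 I. \<Sum>j\<in>insert 0 I. p i j * cell_cost (1 / real (n + 2)) i j) \<le> D + ?e n"
    proof (rule finite_transport_duality[OF fin centre_nz(2), of "\<lambda>z. \<integral>x. w z x \<partial>\<mu>" "\<lambda>z. \<integral>x. w z x \<partial>\<nu>"
          "cell_cost (1 / real (n + 2))" "D + ?e n"])
      fix u v assume "u 0 = 0" "v 0 = 0"
        "\<And>i j. i \<in> insert 0 I \<Longrightarrow> j \<in> insert 0 I \<Longrightarrow> u i + v j \<le> cell_cost (1 / real (n + 2)) i j"
      from cell_potentials_le_dual_value[OF mu nu D this]
      show "(\<Sum>i\<in>I. (\<integral>x. w i x \<partial>\<mu>) * u i) + (\<Sum>j\<in>I. (\<integral>x. w j x \<partial>\<nu>) * v j) \<le> D + ?e n" by simp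
    qed (use nonneg in auto)
    have "levy_cost \<mu> \<nu> \<le> ennreal ((\<Sum>z\<in>insert 0 I. \<Sum>z'\<in>insert 0 I. p z z' * cell_cost (1 / real (n + 2)) z z')
      + (\<integral>x. cell_error (1 / real (n + 2)) (real (n + 2)) x \<partial>\<mu>)
      + (\<integral>x. cell_error (1 / real (n + 2)) (real (n + 2)) x \<partial>\<nu>))"
      by (rule levy_cost_le_cell_plan[OF mu nu p(1-3)])
    also have "\<dots> \<le> ennreal (D + 2 * ?e n)" using add_right_mono[OF p(4), of "?e n"]
      by (intro ennreal_leI) (simp only: mult_2 add.assoc)
    finally show ?thesis .
  qed
  have "(\<lambda>n. D + 2 * ?e n) \<longlonglongrightarrow> D + 2 * (0 + 0)"
    by (intro tendsto_intros cell_error_integral_tendsto_0 mu nu)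
  then have "(\<lambda>n. ennreal (D + 2 * ?e n)) \<longlonglongrightarrow> ennreal D" by (intro tendsto_ennrealI) simp
  then have le: "levy_cost \<mu> \<nu> \<le> ennreal D"
    by (rule LIMSEQ_le_const) (use bound in auto)
  have D0: "0 \<le> D"
  proof -
    have "(\<lambda>_. 0, \<lambda>_. 0) \<in> admissible_pairs (class_C2_bounded_vanishing :: ('a \<Rightarrow> ereal) set)"
      unfolding admissible_pairs_def class_C2_bounded_vanishing_def C2_bounded_def vanishes_near_0_def
      by (auto simp: zero_ereal_def twice_cont_diff_const intro!: exI[of _ "\<lambda>_. 0"])
    then have "ereal_integral \<mu> (\<lambda>_. 0) + ereal_integral \<nu> (\<lambda>_. 0) \<le> dual_value class_C2_bounded_vanishing \<mu> \<nu>"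
      unfolding dual_value_def by (rule SUP_upper2) simp
    from order_trans[OF this D] show ?thesis by (simp add: ereal_integral_def e2ennreal_neg)
  qed
  have "enn2ereal (levy_cost \<mu> \<nu>) \<le> enn2ereal (ennreal D)" using le by (simp add: less_eq_ennreal.rep_eq)
  then show "enn2ereal (levy_cost \<mu> \<nu>) \<le> ereal D" using D0 by (simp add: enn2ereal_ennreal)
qed

lemma class_inclusions:
  shows "class_C2_bounded_vanishing \<subseteq> (class_C2_quadratic_vanishing :: ('a::euclidean_space \<Rightarrow> ereal) set)"
    and "class_C2_quadratic_vanishing \<subseteq> (class_C2_quadratic :: ('a \<Rightarrow> ereal) set)"
    and "class_C2_quadratic \<subseteq> (class_lsc :: ('a \<Rightarrow> ereal) set)"
proof -
  have "f \<in> C2_quadratic" if f: "f \<in> C2_bounded" for f :: "'a \<Rightarrow> real"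
  proof -
    obtain C where C: "C > 0" "\<And>x. \<bar>f x\<bar> \<le> C" using f by (auto simp: C2_bounded_def bounded_pos)
    have "\<bar>f x\<bar> \<le> C * (1 + (norm x)\<^sup>2)" for x
      using C(1) C(2)[of x] by (simp add: distrib_left add_increasing2)
    then show ?thesis using f C(1) by (auto simp: C2_quadratic_def C2_bounded_def)
  qed
  then show "class_C2_bounded_vanishing \<subseteq> (class_C2_quadratic_vanishing :: ('a \<Rightarrow> ereal) set)"
    unfolding class_C2_bounded_vanishing_def class_C2_quadratic_vanishing_def by blast
  show "class_C2_quadratic_vanishing \<subseteq> (class_C2_quadratic :: ('a \<Rightarrow> ereal) set)"
    unfolding class_C2_quadratic_vanishing_def class_C2_quadratic_def by blast
  have "lsc (\<lambda>x. ereal (f x))" if "f \<in> C2_quadratic" for f :: "'a \<Rightarrow> real"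
  proof -
    have "continuous_on UNIV (\<lambda>x. ereal (f x))"
      using that twice_cont_diff_continuous by (auto simp: C2_quadratic_def intro!: continuous_intros)
    then show ?thesis unfolding lsc_def by (auto intro!: open_Collect_less)
  qed
  then show "class_C2_quadratic \<subseteq> (class_lsc :: ('a \<Rightarrow> ereal) set)"
    unfolding class_C2_quadratic_def class_lsc_def by auto
qed

lemma dual_value_mono: "F \<subseteq> G \<Longrightarrow> dual_value F \<mu> \<nu> \<le> dual_value G \<mu> \<nu>"
  unfolding dual_value_def by (rule SUP_subset_mono) (auto simp: admissible_pairs_def)

lemma dual_value_le_levy_cost:
  assumes "\<mu> \<in> Lambda2" and "\<nu> \<in> Lambda2"
  shows "dual_value class_lsc \<mu> \<nu> \<le> enn2ereal (levy_cost \<mu> \<nu>)"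
proof -
  have "ereal_integral \<mu> \<phi> + ereal_integral \<nu> \<psi> \<le> enn2ereal (levy_cost \<mu> \<nu>)"
    if "(\<phi>, \<psi>) \<in> admissible_pairs class_lsc" for \<phi> \<psi>
  proof -
    let ?s = "ereal_integral \<mu> \<phi> + ereal_integral \<nu> \<psi>"
    have "e2ennreal ?s \<le> levy_cost \<mu> \<nu>"
      unfolding levy_cost_def
      using e2ennreal_mono[OF weak_duality[OF assms _ that]] by (intro INF_greatest) simp
    then have "enn2ereal (e2ennreal ?s) \<le> enn2ereal (levy_cost \<mu> \<nu>)" by (simp add: less_eq_ennreal.rep_eq)
    then show ?thesis
      using enn2ereal_e2ennreal[of ?s] order_trans[OF _ enn2ereal_nonneg[of "levy_cost \<mu> \<nu>"], of ?s]
      by (cases "0 \<le> ?s") (auto simp: not_le intro: less_imp_le)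
  qed
  then show ?thesis unfolding dual_value_def by (intro SUP_least) auto
qed

theorem theorem3p23:
  fixes \<mu> \<nu> :: "'a::euclidean_space measure"
  assumes "\<mu> \<in> Lambda2" and "\<nu> \<in> Lambda2"
  shows "enn2ereal (levy_cost \<mu> \<nu>) = dual_value class_lsc \<mu> \<nu>
       \<and> enn2ereal (levy_cost \<mu> \<nu>) = dual_value class_C2_quadratic \<mu> \<nu>
       \<and> enn2ereal (levy_cost \<mu> \<nu>) = dual_value class_C2_quadratic_vanishing \<mu> \<nu>
       \<and> enn2ereal (levy_cost \<mu> \<nu>) = dual_value class_C2_bounded_vanishing \<mu> \<nu>"
  using levy_cost_le_dual_value[OF assms] dual_value_le_levy_cost[OF assms]
    class_inclusions[THEN dual_value_mono, of \<mu> \<nu>]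
  by (meson order.antisym order.trans)

end
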